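(* Let $\Omega\subset\mathbb{C}^n$ be a bounded convex domain with $\mathcal{C}^{1,\,\mathrm{Dini}}$ boundary. Let $z_0\in\Omega$. Then there exists a constant $C>0$ such that $$\mathsf{k}_{\Omega}(z_0,z)\le C+\frac12\log\left(\frac{1}{\mathrm{dist}(z,\Omega^{\mathsf{c}})}\right)\quad\text{for all } z\in\Omega.$$
   Context: $\mathsf{k}_\Omega$ is the Kobayashi distance on $\Omega$, normalized so that on the unit disk $\mathbb{D}$ one has $\mathsf{k}_{\mathbb{D}}(0,\zeta)=\frac12\log\frac{1+|\zeta|}{1-|\zeta|}$; $\Omega^{\mathsf{c}}=\mathbb{C}^n\setminus\Omega$ and $\mathrm{dist}$ is Euclidean distance. A Lebesgue-measurable $g:[0,\epsilon_0)\to[0,\infty)$, $\epsilon_0>0$, satisfies a Dini condition if $\int_0^{\epsilon_0}\frac{g(t)}{t}\,dt<\infty$. A function $f$ is Dini-continuous if it has a modulus of continuity satisfying a Dini condition, i.e. $|f(x)-f(y)|\le\omega(\|x-y\|)$ for $x, y$ in its domain with $\|x-y\|<\epsilon_0$, where $\omega:[0,\epsilon_0)\to[0,\infty)$ is non-decreasing, continuous at $0$ with $\omega(0)=0$, and satisfies a Dini condition. A domain $\Omega\subsetneq\mathbb{C}^n$ has $\mathcal{C}^{1,\,\mathrm{Dini}}$ boundary if $\partial\Omega$ is, near each $\xi\in\partial\Omega$, the graph (relative to a coordinate chart around $\xi$) of a $\mathcal{C}^1$ function whose partial derivatives are Dini-continuous. *)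

theory Defs
  imports "HOL-Complex_Analysis.Complex_Analysis"
begin

definition poincare_dist :: "complex \<Rightarrow> complex \<Rightarrow> real" where
  "poincare_dist a b =
     (let r = cmod ((a - b) / (1 - cnj a * b)) in 1/2 * ln ((1 + r) / (1 - r)))"

lemma poincare_dist_0: "poincare_dist 0 w = 1/2 * ln ((1 + cmod w) / (1 - cmod w))"
  by (simp add: poincare_dist_def Let_def)

definition analytic_disc :: "(complex ^ 'n) set \<Rightarrow> (complex \<Rightarrow> complex ^ 'n) \<Rightarrow> bool" where
  "analytic_disc \<Omega> \<phi> \<longleftrightarrow>
     (\<forall>i. (\<lambda>\<zeta>. \<phi> \<zeta> $ i) holomorphic_on ball 0 1) \<and> \<phi> ` ball 0 1 \<subseteq> \<Omega>"

text \<open>The discs \<open>\<phi> 0, \<dots>, \<phi> (m - 1)\<close> join \<open>z\<close> to \<open>w\<close>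
  through the points \<open>p 0, \<dots>, p m\<close>.\<close>
definition disc_chain ::
  "(complex ^ 'n) set \<Rightarrow> complex ^ 'n \<Rightarrow> complex ^ 'n \<Rightarrow> nat \<Rightarrow>
   (nat \<Rightarrow> complex \<Rightarrow> complex ^ 'n) \<Rightarrow> (nat \<Rightarrow> complex) \<Rightarrow> (nat \<Rightarrow> complex) \<Rightarrow> bool" where
  "disc_chain \<Omega> z w m \<phi> a b \<longleftrightarrow>
     (\<exists>p. p 0 = z \<and> p m = w \<and>
       (\<forall>j<m. analytic_disc \<Omega> (\<phi> j) \<and> a j \<in> ball 0 1 \<and> b j \<in> ball 0 1 \<and>
              \<phi> j (a j) = p j \<and> \<phi> j (b j) = p (Suc j)))"

text \<open>Any two points of a connected open \<open>\<Omega>\<close> are joined by a chain, so that there the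
  infimum is over a nonempty set of nonnegative reals.\<close>
definition kobayashi_dist :: "(complex ^ 'n) set \<Rightarrow> complex ^ 'n \<Rightarrow> complex ^ 'n \<Rightarrow> real" where
  "kobayashi_dist \<Omega> z w =
     Inf {(\<Sum>j<m. poincare_dist (a j) (b j)) | m \<phi> a b. disc_chain \<Omega> z w m \<phi> a b}"

definition dini_condition :: "real \<Rightarrow> (real \<Rightarrow> real) \<Rightarrow> bool" where
  "dini_condition \<epsilon> g \<longleftrightarrow> \<epsilon> > 0 \<and>
     g \<in> borel_measurable (lebesgue_on {0..<\<epsilon>}) \<and> (\<forall>t\<in>{0..<\<epsilon>}. 0 \<le> g t) \<and>
     (\<integral>\<^sup>+ t. ennreal (g t / t) \<partial>lebesgue_on {0..<\<epsilon>}) < \<infinity>"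

definition dini_continuous_on :: "'a::real_normed_vector set \<Rightarrow> ('a \<Rightarrow> real) \<Rightarrow> bool" where
  "dini_continuous_on S f \<longleftrightarrow>
     (\<exists>\<epsilon> \<omega>. mono_on {0..<\<epsilon>} \<omega> \<and> continuous (at 0 within {0..<\<epsilon>}) \<omega> \<and> \<omega> 0 = 0 \<and>
        dini_condition \<epsilon> \<omega> \<and>
        (\<forall>x\<in>S. \<forall>y\<in>S. norm (x - y) < \<epsilon> \<longrightarrow> \<bar>f x - f y\<bar> \<le> \<omega> (norm (x - y))))"

text \<open>Intended for open \<open>S\<close>; \<open>k\<close> times continuously differentiable in the real sense.\<close>
fun Ck_on :: "nat \<Rightarrow> 'a::euclidean_space set \<Rightarrow> ('a \<Rightarrow> 'b::euclidean_space) \<Rightarrow> bool" where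
  "Ck_on 0 S f \<longleftrightarrow> continuous_on S f"
| "Ck_on (Suc k) S f \<longleftrightarrow>
     (\<exists>f'. (\<forall>x\<in>S. (f has_derivative f' x) (at x)) \<and> (\<forall>v. Ck_on k S (\<lambda>x. f' x v)))"

definition coordinate_chart ::
  "'a::euclidean_space set \<Rightarrow> 'a set \<Rightarrow> ('a \<Rightarrow> 'a) \<Rightarrow> bool" where
  "coordinate_chart U V T \<longleftrightarrow> open U \<and> open V \<and>
     (\<exists>T'. homeomorphism U V T T' \<and> (\<forall>k. Ck_on k U T \<and> Ck_on k V T'))"

text \<open>For \<open>b \<in> Basis\<close>: the hyperplane spanned by the remaining coordinate directions.\<close>
definition coordinate_hyperplane :: "'a::euclidean_space \<Rightarrow> 'a set" where
  "coordinate_hyperplane b = {x. x \<bullet> b = 0}"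

text \<open>\<open>D\<close> is a relatively open subset of \<open>coordinate_hyperplane b\<close>; \<open>h' x i\<close> is the partial
  derivative of \<open>h\<close> at \<open>x\<close> in the coordinate direction \<open>i\<close>.\<close>
definition C1_dini_on :: "'a::euclidean_space \<Rightarrow> 'a set \<Rightarrow> ('a \<Rightarrow> real) \<Rightarrow> bool" where
  "C1_dini_on b D h \<longleftrightarrow>
     (\<exists>h'. (\<forall>x\<in>D. (h has_derivative h' x) (at x within D)) \<and>
       (\<forall>i\<in>Basis - {b}. continuous_on D (\<lambda>x. h' x i) \<and> dini_continuous_on D (\<lambda>x. h' x i)))"

text \<open>Here \<open>complex ^ 'n\<close> is used as a real Euclidean space: \<open>Basis\<close> consists of its \<open>2n\<close> real
  coordinate directions, and the graph is taken over all of them but \<open>b\<close>.\<close>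
definition C1_dini_boundary :: "(complex ^ 'n) set \<Rightarrow> bool" where
  "C1_dini_boundary \<Omega> \<longleftrightarrow>
     (\<forall>\<xi>\<in>frontier \<Omega>. \<exists>U V T b D h.
        \<xi> \<in> U \<and> coordinate_chart U V T \<and> b \<in> Basis \<and>
        openin (top_of_set (coordinate_hyperplane b)) D \<and> C1_dini_on b D h \<and>
        T ` (frontier \<Omega> \<inter> U) = {x + h x *\<^sub>R b | x. x \<in> D} \<inter> V)"

end

theory Submission
  imports Defs
begin

text \<open>Near the boundary a single analytic disc gives the sharp constant. Let \<open>\<xi>\<close> be a boundary point
  nearest to \<open>z\<close> and \<open>\<nu>\<close> the inner unit normal, so \<open>z = \<xi> + d \<nu>\<close>. Convexity and the Dini condition
  give a modulus \<open>\<psi>\<close>, independent of \<open>\<xi>\<close>, with \<open>\<Sum>\<^sub>j \<psi> (2\<^sup>-\<^sup>j) < \<infinity>\<close> such that \<open>\<xi> + w \<nu> \<in> \<Omega>\<close> for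
  all small complex \<open>w\<close> with \<open>Re w > |w| \<psi> |w|\<close>. The map
  \<open>F \<zeta> = \<zeta> + \<Sum>\<^sub>j c\<^sub>j \<zeta> \<rho>\<^sub>j / (\<zeta> + \<rho>\<^sub>j)\<close> with \<open>\<rho>\<^sub>j\<close> dyadic and \<open>c\<^sub>j\<close> a multiple of \<open>\<psi> (2 \<rho>\<^sub>j)\<close> sends the right
  half plane near \<open>0\<close> into that region, because the \<open>j\<close>-th term has real part at least a multiple
  of \<open>c\<^sub>j |\<zeta>|\<close> when \<open>|\<zeta>|\<close> is comparable to \<open>\<rho>\<^sub>j\<close>; and \<open>t \<le> F t \<le> 2 t\<close> for real \<open>t > 0\<close> by
  summability. The disc \<open>\<zeta> \<mapsto> \<xi> + F (r\<^sub>0 (1 + \<zeta>)) \<nu>\<close> then joins \<open>z\<close> to a point at distance bounded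
  below from the boundary, at Poincare cost \<open>1/2 ln (1/d) + O(1)\<close>, and such points are joined to
  \<open>z\<^sub>0\<close> by a bounded number of Euclidean discs.\<close>

section \<open>Dini moduli\<close>

text \<open>For a monotone function the sum over dyadic points is comparable to the integral of
  \<open>\<psi> t / t\<close> near 0, so this is the Dini condition in discrete form. Taking
  \<open>\<psi>\<close> on the whole half line removes domain bounds from later estimates.\<close>

definition dini_modulus :: "(real \<Rightarrow> real) \<Rightarrow> bool" where
  "dini_modulus \<psi> \<longleftrightarrow>
     mono_on {0..} \<psi> \<and> (\<forall>t\<ge>0. 0 \<le> \<psi> t) \<and> summable (\<lambda>j. \<psi> ((1/2) ^ j))"

section \<open>Closure properties of Dini moduli\<close>

lemma dini_modulus_mono: "dini_modulus \<psi> \<Longrightarrow> 0 \<le> s \<Longrightarrow> s \<le> t \<Longrightarrow> \<psi> s \<le> \<psi> t"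
  by (auto simp: dini_modulus_def mono_on_def)

lemma dini_modulus_nonneg: "dini_modulus \<psi> \<Longrightarrow> 0 \<le> t \<Longrightarrow> 0 \<le> \<psi> t"
  by (auto simp: dini_modulus_def)

lemma dini_modulus_zero: "dini_modulus (\<lambda>_. 0)"
  by (auto simp: dini_modulus_def mono_on_def)

lemma dini_modulus_ident: "dini_modulus (\<lambda>t. t)"
  by (auto simp: dini_modulus_def mono_on_def intro!: summable_geometric)

lemma dini_modulus_add:
  "dini_modulus \<psi> \<Longrightarrow> dini_modulus \<theta> \<Longrightarrow> dini_modulus (\<lambda>t. \<psi> t + \<theta> t)"
  by (auto simp: dini_modulus_def mono_on_def intro!: summable_add add_mono)

lemma dini_modulus_cmult: "dini_modulus \<psi> \<Longrightarrow> 0 \<le> c \<Longrightarrow> dini_modulus (\<lambda>t. c * \<psi> t)"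
  by (auto simp: dini_modulus_def mono_on_def intro!: mult_left_mono)

lemma dini_modulus_sum:
  assumes "finite I" "\<And>i. i \<in> I \<Longrightarrow> dini_modulus (\<psi> i)"
  shows "dini_modulus (\<lambda>t. \<Sum>i\<in>I. \<psi> i t)"
  using assms by (induction I) (auto intro: dini_modulus_zero dini_modulus_add)

text \<open>With \<open>L \<le> 2 ^ k\<close>, rescaling amounts at worst to a shift of the dyadic
  index by \<open>k\<close>, and finitely many initial terms do not affect summability.\<close>

lemma dini_modulus_scale:
  assumes "dini_modulus \<psi>" "0 \<le> L"
  shows "dini_modulus (\<lambda>t. \<psi> (L * t))"
proof -
  obtain k :: nat where k: "L \<le> 2 ^ k"
    using real_arch_pow[of 2 L] by (auto intro: less_imp_le)
  have "summable (\<lambda>j. \<psi> ((1/2) ^ j))"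
    using assms(1) by (simp add: dini_modulus_def)
  moreover have "norm (\<psi> (L * (1/2) ^ (j + k))) \<le> \<psi> ((1/2) ^ j)" for j
  proof -
    have "L * (1/2) ^ (j + k) \<le> 2 ^ k * (1/2) ^ (j + k)"
      using k by (intro mult_right_mono) auto
    also have "\<dots> = (1/2) ^ j"
      by (simp add: power_add power_divide)
    finally show ?thesis
      using dini_modulus_nonneg[OF assms(1)] assms(2) by (simp add: dini_modulus_mono[OF assms(1)])
  qed
  ultimately have "summable (\<lambda>j. \<psi> (L * (1/2) ^ (j + k)))"
    by (rule summable_comparison_test'[where N = 0])
  then have "summable (\<lambda>j. \<psi> (L * (1/2) ^ j))"
    by (simp only: summable_iff_shift[of "\<lambda>j. \<psi> (L * (1/2) ^ j)" k])
  moreover have "mono_on {0..} (\<lambda>t. \<psi> (L * t))"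
    using assms(2) by (intro mono_onI dini_modulus_mono[OF assms(1)]) (simp_all add: mult_left_mono)
  ultimately show ?thesis
    using assms(2) by (simp add: dini_modulus_def dini_modulus_nonneg[OF assms(1)])
qed

text \<open>Summable terms tend to 0, and monotonicity carries the bound from one dyadic point to
  the whole interval below it.\<close>

lemma dini_modulus_small:
  assumes "dini_modulus \<psi>" "0 < e"
  obtains \<delta> where "0 < \<delta>" "\<And>t. 0 \<le> t \<Longrightarrow> t \<le> \<delta> \<Longrightarrow> \<psi> t < e"
proof -
  have "(\<lambda>j. \<psi> ((1/2) ^ j)) \<longlonglongrightarrow> 0"
    using assms by (intro summable_LIMSEQ_zero) (simp add: dini_modulus_def)
  then have "\<forall>\<^sub>F j in sequentially. \<psi> ((1/2) ^ j) < e"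
    using assms(2) by (rule order_tendstoD)
  then obtain j where "\<psi> ((1/2) ^ j) < e"
    by (auto simp: eventually_sequentially)
  then show thesis
    by (intro that[of "(1/2) ^ j"]) (auto intro: le_less_trans[OF dini_modulus_mono[OF assms(1)]])
qed

text \<open>On \<open>[2\<^sup>-\<^sup>j, 2\<^sup>1\<^sup>-\<^sup>j)\<close> the integrand is at least \<open>\<omega> (2\<^sup>-\<^sup>j) / 2\<^sup>1\<^sup>-\<^sup>j\<close>.\<close>
lemma dini_condition_summable:
  assumes dini: "dini_condition \<epsilon> \<omega>" and mono: "mono_on {0..<\<epsilon>} \<omega>" and N: "2 * (1/2) ^ N \<le> \<epsilon>"
  shows "summable (\<lambda>j. \<omega> ((1/2) ^ (j + N)))"
proof -
  define M where "M = lebesgue_on {0..<\<epsilon>}"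
  define g where "g = (\<lambda>t. ennreal (\<omega> t / t))"
  define A where "A j = {(1/2) ^ (j + N)..<2 * (1/2 :: real) ^ (j + N)}" for j
  have nonneg: "0 \<le> \<omega> t" if "t \<in> {0..<\<epsilon>}" for t
    using dini that by (auto simp: dini_condition_def)
  have [measurable]: "\<omega> \<in> borel_measurable M"
    using dini by (auto simp: dini_condition_def M_def)
  have [measurable]: "(\<lambda>t. t) \<in> borel_measurable M"
    unfolding M_def by (intro measurable_restrict_space1 measurable_completion) simp
  have g[measurable]: "g \<in> borel_measurable M"
    unfolding g_def by measurable
  have fin: "(\<integral>\<^sup>+ t. g t \<partial>M) < \<infinity>"
    using dini by (simp add: dini_condition_def M_def g_def)
  have le: "2 * (1/2 :: real) ^ (j + N) \<le> \<epsilon>" for j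
  proof -
    have "(1/2 :: real) ^ (j + N) \<le> (1/2) ^ N"
      by (intro power_decreasing) auto
    then show ?thesis using N by linarith
  qed
  have Asub: "A j \<subseteq> {0..<\<epsilon>}" for j
  proof
    fix t assume "t \<in> A j"
    then have "(1/2) ^ (j + N) \<le> t" "t < 2 * (1/2) ^ (j + N)" by (simp_all add: A_def)
    moreover have "(0::real) < (1/2) ^ (j + N)" by simp
    ultimately show "t \<in> {0..<\<epsilon>}" using le[of j] unfolding atLeastLessThan_iff by linarith
  qed
  have A[measurable]: "A j \<in> sets M" for j
    using Asub unfolding M_def by (auto simp: sets_restrict_space_iff A_def)
  have disj: "disjoint_family A"
  proof -
    have "A i \<inter> A j = {}" if "i < j" for i j
    proof -
      have "(1/2 :: real) ^ (j + N) \<le> (1/2) ^ (Suc i + N)"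
        using that by (intro power_decreasing) auto
      then show ?thesis unfolding A_def by auto
    qed
    then show ?thesis
      unfolding disjoint_family_on_def by (metis Int_commute linorder_neqE_nat)
  qed
  \<comment> \<open>The measure with density \<open>g\<close> lets countable additivity over the
    disjoint \<open>A j\<close> bound the whole sum by one integral.\<close>
  have lower: "ennreal (\<omega> ((1/2) ^ (j + N)) / 2) \<le> emeasure (density M g) (A j)" for j
  proof -
    define \<rho> where "\<rho> = (1/2 :: real) ^ (j + N)"
    have \<rho>: "\<rho> > 0" "2 * \<rho> \<le> \<epsilon>"
      using le[of j] by (simp_all add: \<rho>_def)
    have "emeasure M (A j) = emeasure lebesgue (A j)"
      unfolding M_def using Asub by (intro emeasure_restrict_space) auto
    then have Aj: "emeasure M (A j) = ennreal \<rho>"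
      using \<rho>(1) by (simp add: A_def \<rho>_def[symmetric])
    have "ennreal (\<omega> \<rho> / 2) = ennreal (\<omega> \<rho> / (2 * \<rho>)) * emeasure M (A j)"
      using \<rho> nonneg by (simp add: Aj ennreal_mult' [symmetric])
    also have "\<dots> = (\<integral>\<^sup>+ t. ennreal (\<omega> \<rho> / (2 * \<rho>)) * indicator (A j) t \<partial>M)"
      by (subst nn_integral_cmult_indicator) simp_all
    also have "\<dots> \<le> (\<integral>\<^sup>+ t. g t * indicator (A j) t \<partial>M)"
    proof (intro nn_integral_mono)
      fix t
      have "\<omega> \<rho> / (2 * \<rho>) \<le> \<omega> t / t" if "t \<in> A j"
      proof (rule frac_le)
        have t: "\<rho> \<le> t" "t < 2 * \<rho>" using that by (auto simp: A_def \<rho>_def)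
        show "\<omega> \<rho> \<le> \<omega> t"
          using mono t \<rho> by (auto simp: mono_on_def)
        show "0 < t" "t \<le> 2 * \<rho>" "0 \<le> \<omega> t"
          using t \<rho> nonneg by auto
      qed
      then show "ennreal (\<omega> \<rho> / (2 * \<rho>)) * indicator (A j) t \<le> g t * indicator (A j) t"
        by (auto simp: g_def indicator_def intro!: ennreal_leI)
    qed
    also have "\<dots> = emeasure (density M g) (A j)"
      by (simp add: emeasure_density)
    finally show ?thesis by (simp add: \<rho>_def)
  qed
  have "(\<Sum>j. ennreal (\<omega> ((1/2) ^ (j + N)) / 2)) \<le> (\<Sum>j. emeasure (density M g) (A j))"
    by (intro suminf_le lower) auto
  also have "\<dots> = emeasure (density M g) (\<Union>j. A j)"
    using disj by (intro suminf_emeasure) auto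
  also have "\<dots> \<le> (\<integral>\<^sup>+ t. g t \<partial>M)"
    by (subst emeasure_density) (auto intro!: nn_integral_mono simp: indicator_def)
  finally have "(\<Sum>j. ennreal (\<omega> ((1/2) ^ (j + N)) / 2)) < \<infinity>"
    using fin by (rule le_less_trans)
  \<comment> \<open>Nonnegativity lets a finite sum of \<open>ennreal\<close> values yield a
    convergent real series.\<close>
  moreover have "0 \<le> \<omega> ((1/2) ^ (j + N)) / 2" for j
  proof -
    have "(0::real) < (1/2) ^ (j + N)" by simp
    then have "(1/2) ^ (j + N) \<in> {0..<\<epsilon>}"
      using le[of j] unfolding atLeastLessThan_iff by linarith
    then show ?thesis using nonneg by simp
  qed
  ultimately have "summable (\<lambda>j. \<omega> ((1/2) ^ (j + N)) / 2)"
    by (intro summable_suminf_not_top) auto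
  then show ?thesis
    by (simp add: summable_divide_iff)
qed

lemma dini_continuous_on_modulus:
  assumes "dini_continuous_on S f"
  obtains \<epsilon> \<psi> where "0 < \<epsilon>" "dini_modulus \<psi>"
    "\<And>x y. x \<in> S \<Longrightarrow> y \<in> S \<Longrightarrow> norm (x - y) < \<epsilon> \<Longrightarrow> \<bar>f x - f y\<bar> \<le> \<psi> (norm (x - y))"
proof -
  obtain \<epsilon> \<omega> where mono: "mono_on {0..<\<epsilon>} \<omega>" and dini: "dini_condition \<epsilon> \<omega>"
    and f: "\<And>x y. x \<in> S \<Longrightarrow> y \<in> S \<Longrightarrow> norm (x - y) < \<epsilon> \<Longrightarrow> \<bar>f x - f y\<bar> \<le> \<omega> (norm (x - y))"
    using assms unfolding dini_continuous_on_def by blast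
  \<comment> \<open>Freezing \<open>\<omega>\<close> at \<open>\<epsilon> / 2\<close> extends it
    monotonically to the half line; the radius is halved below so that \<open>\<psi>\<close> agrees
    with \<open>\<omega>\<close> there.\<close>
  define \<psi> where "\<psi> t = \<omega> (min t (\<epsilon> / 2))" for t
  have eps: "\<epsilon> > 0" and nonneg: "\<And>t. t \<in> {0..<\<epsilon>} \<Longrightarrow> 0 \<le> \<omega> t"
    using dini by (auto simp: dini_condition_def)
  obtain N where N: "(1/2 :: real) ^ N < \<epsilon> / 2"
    using real_arch_pow_inv[of "\<epsilon> / 2" "1/2"] eps by auto
  have "summable (\<lambda>j. \<omega> ((1/2) ^ (j + N)))"
    using N by (intro dini_condition_summable[OF dini mono]) auto
  moreover have "\<psi> ((1/2) ^ (j + N)) = \<omega> ((1/2) ^ (j + N))" for j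
  proof -
    have "(1/2 :: real) ^ (j + N) \<le> (1/2) ^ N"
      by (intro power_decreasing) auto
    then have "(1/2 :: real) ^ (j + N) < \<epsilon> / 2"
      using N by (rule le_less_trans)
    then show ?thesis by (simp add: \<psi>_def)
  qed
  ultimately have "summable (\<lambda>j. \<psi> ((1/2) ^ (j + N)))" by simp
  then have "summable (\<lambda>j. \<psi> ((1/2) ^ j))"
    by (simp only: summable_iff_shift[of "\<lambda>j. \<psi> ((1/2) ^ j)" N])
  then have "dini_modulus \<psi>"
    using eps nonneg mono_onD[OF mono] unfolding dini_modulus_def \<psi>_def
    by (auto intro!: mono_onI mono_onD[OF mono])
  moreover have "\<bar>f x - f y\<bar> \<le> \<psi> (norm (x - y))" if "x \<in> S" "y \<in> S" "norm (x - y) < \<epsilon> / 2" for x y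
    using f[OF that(1,2)] that(3) eps by (simp add: \<psi>_def)
  ultimately show thesis
    using eps that[of "\<epsilon> / 2" \<psi>] by simp
qed

section \<open>A holomorphic map into a cusped half plane\<close>

lemma half_plane_map:
  assumes \<psi>: "dini_modulus \<psi>"
  obtains \<delta> F where "0 < \<delta>" "F holomorphic_on {\<zeta>. Re \<zeta> > 0}"
    "\<And>\<zeta>. Re \<zeta> > 0 \<Longrightarrow> cmod (F \<zeta>) \<le> 2 * cmod \<zeta>"
    "\<And>\<zeta>. Re \<zeta> > 0 \<Longrightarrow> cmod \<zeta> < \<delta> \<Longrightarrow> cmod (F \<zeta>) * \<psi> (cmod (F \<zeta>)) < Re (F \<zeta>)"
    "\<And>t. t > 0 \<Longrightarrow> Im (F (of_real t)) = 0" "\<And>t. t > 0 \<Longrightarrow> t \<le> Re (F (of_real t))"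
proof -
  \<comment> \<open>In \<open>18 = 2 * 9\<close> the 9 offsets a loss of
    \<open>(1 / 3)\<^sup>2\<close> in the dyadic term, and the 2 comes from
    \<open>cmod (F \<zeta>) \<le> 2 * cmod \<zeta>\<close>. Dropping the first \<open>N\<close>
    terms makes the coefficients sum to at most 1, which gives this very bound.\<close>
  have sm0: "summable (\<lambda>j. 18 * \<psi> (2 * (1/2) ^ j))"
    using dini_modulus_scale[OF \<psi>, of 2] by (auto simp: dini_modulus_def intro!: summable_mult)
  obtain N where N: "norm (\<Sum>j. 18 * \<psi> (2 * (1/2) ^ (j + N))) < 1"
    using suminf_exist_split[OF zero_less_one sm0] by auto
  define \<rho> :: "nat \<Rightarrow> real" where "\<rho> j = (1/2) ^ (j + N)" for j
  define c where "c j = 18 * \<psi> (2 * \<rho> j)" for j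
  have \<rho>: "\<rho> j > 0" for j by (simp add: \<rho>_def)
  have c: "c j \<ge> 0" for j
    using dini_modulus_nonneg[OF \<psi>] \<rho>[of j] by (simp add: c_def)
  have smc: "summable c"
    using sm0 unfolding c_def \<rho>_def by (simp only: summable_iff_shift[of "\<lambda>j. 18 * \<psi> (2 * (1/2) ^ j)" N])
  have sumc: "suminf c \<le> 1"
    using N by (simp add: c_def[abs_def] \<rho>_def)
  define g where "g j \<zeta> = of_real (c j * \<rho> j) * \<zeta> / (\<zeta> + of_real (\<rho> j))" for j and \<zeta> :: complex
  define F where "F \<zeta> = \<zeta> + (\<Sum>j. g j \<zeta>)" for \<zeta>
  let ?H = "{\<zeta>. Re \<zeta> > 0}"
  have ne: "\<zeta> + of_real (\<rho> j) \<noteq> 0" if "Re \<zeta> > 0" for \<zeta> j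
  proof -
    have "Re (\<zeta> + of_real (\<rho> j)) > 0"
      using that \<rho>[of j] by simp
    then show ?thesis by force
  qed
  have gnorm: "cmod (g j \<zeta>) \<le> c j * cmod \<zeta>" if "Re \<zeta> > 0" for j \<zeta>
  proof -
    have "\<rho> j \<le> Re (\<zeta> + of_real (\<rho> j))" using that by simp
    also have "\<dots> \<le> cmod (\<zeta> + of_real (\<rho> j))" by (rule complex_Re_le_cmod)
    finally have "\<rho> j / cmod (\<zeta> + of_real (\<rho> j)) \<le> 1"
      using \<rho>[of j] by (simp add: divide_le_eq_1)
    then have "c j * cmod \<zeta> * (\<rho> j / cmod (\<zeta> + of_real (\<rho> j))) \<le> c j * cmod \<zeta> * 1"
      using c by (intro mult_left_mono) auto
    then show ?thesis
      using c[of j] \<rho>[of j] by (simp add: g_def norm_mult norm_divide mult_ac)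
  qed
  have gsm: "summable (\<lambda>j. cmod (g j \<zeta>))" if "Re \<zeta> > 0" for \<zeta>
    by (rule summable_comparison_test'[OF summable_mult2[OF smc, of "cmod \<zeta>"], of 0])
      (simp add: gnorm[OF that])
  have gsm': "summable (\<lambda>j. g j \<zeta>)" if "Re \<zeta> > 0" for \<zeta>
    using gsm[OF that] by (rule summable_norm_cancel)
  \<comment> \<open>\<open>Re (\<zeta> / (\<zeta> + \<rho>)) = (|\<zeta>|^2 + \<rho> Re \<zeta>) /
    |\<zeta> + \<rho>|^2\<close>, and the second term of the numerator is positive on the half
    plane.\<close>
  have gRe: "Re (g j \<zeta>) \<ge> c j * \<rho> j * (cmod \<zeta> / (cmod \<zeta> + \<rho> j))\<^sup>2" if "Re \<zeta> > 0" for j \<zeta>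
  proof -
    have m: "0 < cmod (\<zeta> + of_real (\<rho> j))" "cmod (\<zeta> + of_real (\<rho> j)) \<le> cmod \<zeta> + \<rho> j"
      using ne[OF that] norm_triangle_ineq[of \<zeta> "of_real (\<rho> j)"] \<rho>[of j] by (auto simp del: of_real_add)
    have "\<zeta> / (\<zeta> + of_real (\<rho> j)) = \<zeta> * cnj (\<zeta> + of_real (\<rho> j)) / of_real ((cmod (\<zeta> + of_real (\<rho> j)))\<^sup>2)"
      by (subst complex_div_cnj) simp
    then have "Re (\<zeta> / (\<zeta> + of_real (\<rho> j))) = Re (\<zeta> * cnj (\<zeta> + of_real (\<rho> j))) / (cmod (\<zeta> + of_real (\<rho> j)))\<^sup>2"
      by (simp only: Re_divide_of_real)
    moreover have "Re (\<zeta> * cnj (\<zeta> + of_real (\<rho> j))) \<ge> (cmod \<zeta>)\<^sup>2"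
      using that \<rho>[of j] by (simp add: cmod_def algebra_simps power2_eq_square)
    ultimately have "Re (\<zeta> / (\<zeta> + of_real (\<rho> j))) \<ge> (cmod \<zeta>)\<^sup>2 / (cmod (\<zeta> + of_real (\<rho> j)))\<^sup>2"
      by (simp add: divide_right_mono)
    moreover have "(cmod \<zeta>)\<^sup>2 / (cmod (\<zeta> + of_real (\<rho> j)))\<^sup>2 \<ge> (cmod \<zeta>)\<^sup>2 / (cmod \<zeta> + \<rho> j)\<^sup>2"
      using m by (intro divide_left_mono power_mono mult_pos_pos) auto
    ultimately have "c j * \<rho> j * (cmod \<zeta> / (cmod \<zeta> + \<rho> j))\<^sup>2 \<le> c j * \<rho> j * Re (\<zeta> / (\<zeta> + of_real (\<rho> j)))"
      using c[of j] \<rho>[of j] by (intro mult_left_mono) (auto simp: power_divide)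
    also have "\<dots> = Re (g j \<zeta>)"
    proof -
      have "g j \<zeta> = of_real (c j * \<rho> j) * (\<zeta> / (\<zeta> + of_real (\<rho> j)))"
        by (simp add: g_def)
      then show ?thesis by (simp only: Re_complex_of_real Im_complex_of_real times_complex.sel mult_zero_left diff_zero)
    qed
    finally show ?thesis .
  qed
  have gRe0: "Re (g j \<zeta>) \<ge> 0" if "Re \<zeta> > 0" for j \<zeta>
    using c[of j] \<rho>[of j] by (intro order_trans[OF _ gRe[OF that, of j]]) simp
  have ReF: "Re (F \<zeta>) = Re \<zeta> + (\<Sum>j. Re (g j \<zeta>))" and smRe: "summable (\<lambda>j. Re (g j \<zeta>))"
    if "Re \<zeta> > 0" for \<zeta>
    using gsm'[OF that] by (auto simp: F_def Re_suminf intro: summable_Re)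
  have Fnorm: "cmod (F \<zeta>) \<le> 2 * cmod \<zeta>" if "Re \<zeta> > 0" for \<zeta>
  proof -
    have "cmod (\<Sum>j. g j \<zeta>) \<le> (\<Sum>j. c j * cmod \<zeta>)"
      by (rule norm_suminf_le[OF gnorm[OF that] summable_mult2[OF smc]])
    also have "\<dots> = suminf c * cmod \<zeta>"
      using suminf_mult2[OF smc, of "cmod \<zeta>"] by simp
    also have "\<dots> \<le> cmod \<zeta>"
      using sumc by (simp add: mult_left_le_one_le suminf_nonneg smc c)
    finally show ?thesis
      unfolding F_def using norm_triangle_ineq[of \<zeta> "\<Sum>j. g j \<zeta>"] by linarith
  qed
  have hol: "F holomorphic_on ?H"
  proof -
    have "(\<lambda>\<zeta>. \<Sum>j. g j \<zeta>) holomorphic_on ?H"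
    proof (rule holomorphic_uniform_sequence[where f = "\<lambda>n \<zeta>. \<Sum>j<n. g j \<zeta>"])
      show "open ?H" by (rule open_halfspace_Re_gt)
      show "(\<lambda>\<zeta>. \<Sum>j<n. g j \<zeta>) holomorphic_on ?H" for n
        unfolding g_def using ne by (intro holomorphic_intros) auto
      fix z assume z: "z \<in> ?H"
      obtain d where d: "d > 0" "cball z d \<subseteq> ?H"
        using open_contains_cball[of ?H] open_halfspace_Re_gt[of 0] z by auto
      have "uniform_limit (cball z d) (\<lambda>n \<zeta>. \<Sum>j<n. g j \<zeta>) (\<lambda>\<zeta>. \<Sum>j. g j \<zeta>) sequentially"
      proof (rule Weierstrass_m_test)
        show "summable (\<lambda>j. c j * (cmod z + d))" using smc by (rule summable_mult2)
        fix j \<zeta> assume \<zeta>: "\<zeta> \<in> cball z d"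
        then have "cmod \<zeta> \<le> cmod z + d"
          using norm_triangle_ineq2[of \<zeta> z] by (simp add: dist_norm norm_minus_commute)
        then show "norm (g j \<zeta>) \<le> c j * (cmod z + d)"
          using d(2) \<zeta> by (intro order_trans[OF gnorm mult_left_mono] c) auto
      qed
      then show "\<exists>d>0. cball z d \<subseteq> ?H \<and>
          uniform_limit (cball z d) (\<lambda>n \<zeta>. \<Sum>j<n. g j \<zeta>) (\<lambda>\<zeta>. \<Sum>j. g j \<zeta>) sequentially"
        using d by blast
    qed
    then show ?thesis unfolding F_def by (intro holomorphic_intros)
  qed
  have main: "cmod (F \<zeta>) * \<psi> (cmod (F \<zeta>)) < Re (F \<zeta>)" if \<zeta>: "Re \<zeta> > 0" "cmod \<zeta> < \<rho> 0" for \<zeta>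
  proof -
    define x where "x = cmod \<zeta>"
    have x: "x > 0" unfolding x_def using \<zeta>(1) complex_Re_le_cmod[of \<zeta>] by linarith
    \<comment> \<open>\<open>j\<close> is the dyadic scale of \<open>\<zeta>\<close>; the least
      index \<open>m\<close> is not 0 because \<open>cmod \<zeta> < \<rho> 0\<close>.\<close>
    have "\<exists>j. \<rho> (Suc j) < x \<and> x \<le> \<rho> j"
    proof -
      obtain k where "(1/2 :: real) ^ k < x" using real_arch_pow_inv[OF x, of "1/2"] by auto
      moreover have "\<rho> k \<le> (1/2) ^ k" unfolding \<rho>_def by (intro power_decreasing) auto
      ultimately have ex: "\<rho> k < x" by linarith
      define m where "m = (LEAST k. \<rho> k < x)"
      have m: "\<rho> m < x" unfolding m_def using ex by (rule LeastI)
      have "m \<noteq> 0"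
      proof
        assume "m = 0"
        then show False using m \<zeta>(2) by (simp add: x_def)
      qed
      then obtain j where "m = Suc j" using not0_implies_Suc by blast
      moreover have "\<not> \<rho> j < x" using not_less_Least[of j "\<lambda>k. \<rho> k < x"] \<open>m = Suc j\<close> m_def by simp
      ultimately show ?thesis using m by auto
    qed
    then obtain j where j: "\<rho> (Suc j) < x" "x \<le> \<rho> j" by blast
    have j': "\<rho> j < 2 * x" using j by (simp add: \<rho>_def)
    \<comment> \<open>Only the term at this scale is estimated; the others have nonnegative real
      part.\<close>
    have "1 / 3 \<le> x / (x + \<rho> j)"
      using x \<rho>[of j] j' by (simp add: field_simps)
    then have "(1 / 3)\<^sup>2 \<le> (x / (x + \<rho> j))\<^sup>2"
      by (intro power_mono) auto
    then have "c j * \<rho> j * (1 / 3)\<^sup>2 \<le> c j * \<rho> j * (x / (x + \<rho> j))\<^sup>2"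
      using c[of j] \<rho>[of j] by (intro mult_left_mono) auto
    then have "c j * \<rho> j / 9 \<le> c j * \<rho> j * (x / (x + \<rho> j))\<^sup>2"
      by (simp add: power2_eq_square)
    moreover have "c j * x / 9 \<le> c j * \<rho> j / 9"
      using c[of j] j by (intro divide_right_mono mult_left_mono) auto
    moreover have "c j * \<rho> j * (x / (x + \<rho> j))\<^sup>2 \<le> Re (g j \<zeta>)"
      using gRe[OF \<zeta>(1)] by (simp add: x_def)
    moreover have "Re (g j \<zeta>) \<le> (\<Sum>j. Re (g j \<zeta>))"
      using sum_le_suminf[OF smRe[OF \<zeta>(1)], of "{j}"] gRe0[OF \<zeta>(1)] by simp
    moreover have "2 * x * \<psi> (2 * \<rho> j) = c j * x / 9"
      by (simp add: c_def)
    \<comment> \<open>The remaining summand \<open>Re \<zeta>\<close> makes the inequality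
      strict.\<close>
    ultimately have "2 * x * \<psi> (2 * \<rho> j) < Re (F \<zeta>)"
      using \<zeta>(1) ReF[OF \<zeta>(1)] by linarith
    \<comment> \<open>Here \<open>cmod (F \<zeta>) \<le> 2 * x \<le> 2 * \<rho> j\<close>, which is
      why \<open>c j\<close> samples \<open>\<psi>\<close> at \<open>2 * \<rho> j\<close>.\<close>
    moreover have "cmod (F \<zeta>) * \<psi> (cmod (F \<zeta>)) \<le> 2 * x * \<psi> (2 * \<rho> j)"
      using Fnorm[OF \<zeta>(1)] j(2) x dini_modulus_nonneg[OF \<psi>] dini_modulus_mono[OF \<psi>]
      by (intro mult_mono) (auto simp: x_def)
    ultimately show ?thesis by linarith
  qed
  have Im0: "Im (F (of_real t)) = 0" if "t > 0" for t
  proof -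
    have "Im (g j (of_real t)) = 0" for j
      unfolding g_def by (metis Im_complex_of_real of_real_add of_real_divide of_real_mult)
    then show ?thesis
      using that gsm'[of "of_real t"] by (simp add: F_def Im_suminf)
  qed
  have ReT: "t \<le> Re (F (of_real t))" if "t > 0" for t
    using that gRe0[of "of_real t"] smRe[of "of_real t"] by (simp add: ReF suminf_nonneg)
  show thesis
    by (rule that[of "\<rho> 0" F]) (use \<rho> hol Fnorm main Im0 ReT in auto)
qed

section \<open>Flatness of the boundary\<close>

lemma bounded_linear_norm_le_Basis:
  fixes f :: "'a::euclidean_space \<Rightarrow> 'b::real_normed_vector"
  assumes "bounded_linear f"
  shows "norm (f v) \<le> (\<Sum>i\<in>Basis. norm (f i)) * norm v"
  using onorm[OF assms, of v] onorm_componentwise[OF assms]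
  by (meson mult_right_mono norm_ge_zero order_trans)

lemma norm_le_norm_add_orthogonal:
  fixes w :: "'a::real_inner"
  assumes "w \<bullet> b = 0"
  shows "norm w \<le> norm (w + c *\<^sub>R b)"
proof -
  have "(w + c *\<^sub>R b) \<bullet> (w + c *\<^sub>R b) = w \<bullet> w + (c * c) * (b \<bullet> b)"
    using assms by (simp add: inner_add_left inner_add_right inner_commute[of b w])
  then show ?thesis
    by (simp add: norm_le)
qed

text \<open>The operator norm of the derivative is at most the sum of its norms on basis vectors,
  which is continuous and so bounded on the compact ball; convexity allows the mean value
  inequality.\<close>

lemma Ck_on_1_lipschitz:
  fixes f :: "'a::euclidean_space \<Rightarrow> 'b::euclidean_space"
  assumes "Ck_on 1 S f" and sub: "cball x r \<subseteq> S"
  obtains L where "0 \<le> L"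
    "\<And>y z. y \<in> cball x r \<Longrightarrow> z \<in> cball x r \<Longrightarrow> norm (f y - f z) \<le> L * norm (y - z)"
proof -
  obtain f' where f': "\<And>x. x \<in> S \<Longrightarrow> (f has_derivative f' x) (at x)"
    and cont: "\<And>v. continuous_on S (\<lambda>x. f' x v)"
    using assms(1) by auto
  have "continuous_on (cball x r) (\<lambda>y. \<Sum>i\<in>Basis. norm (f' y i))"
    by (intro continuous_intros continuous_on_subset[OF cont sub])
  then have "bounded ((\<lambda>y. \<Sum>i\<in>Basis. norm (f' y i)) ` cball x r)"
    by (intro compact_imp_bounded compact_continuous_image) auto
  then obtain B where B: "B > 0" "\<And>y. y \<in> cball x r \<Longrightarrow> (\<Sum>i\<in>Basis. norm (f' y i)) \<le> B"
    unfolding bounded_pos by (auto simp: sum_nonneg)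
  have "norm (f y - f z) \<le> B * norm (y - z)" if "y \<in> cball x r" "z \<in> cball x r" for y z
  proof (rule differentiable_bound[OF convex_cball _ _ that])
    fix u assume u: "u \<in> cball x r"
    have d: "(f has_derivative f' u) (at u)" using f' u sub by auto
    then show "(f has_derivative f' u) (at u within cball x r)"
      by (rule has_derivative_at_withinI)
    show "onorm (f' u) \<le> B"
      using onorm_componentwise[OF has_derivative_bounded_linear[OF d]] B(2)[OF u] by linarith
  qed
  then show thesis using that[of B] B(1) by auto
qed

text \<open>Each \<open>f' y i\<close> is itself of class C1, hence Lipschitz in \<open>y\<close>;
  expanding the direction in the basis makes the constant uniform in \<open>v\<close>.\<close>

lemma Ck_on_2_derivative_lipschitz:
  fixes f :: "'a::euclidean_space \<Rightarrow> 'b::euclidean_space"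
  assumes "Ck_on 2 S f" and sub: "cball x r \<subseteq> S" and r: "0 \<le> r"
  obtains f' K M where "0 \<le> K" "0 \<le> M" "\<And>x. x \<in> S \<Longrightarrow> (f has_derivative f' x) (at x)"
    "\<And>y v. y \<in> cball x r \<Longrightarrow> norm (f' y v) \<le> M * norm v"
    "\<And>y z v. y \<in> cball x r \<Longrightarrow> z \<in> cball x r \<Longrightarrow>
      norm (f' y v - f' z v) \<le> K * norm (y - z) * norm v"
proof -
  have "Ck_on (Suc 1) S f" using assms(1) by (simp add: numeral_2_eq_2)
  then obtain f' where f': "\<And>x. x \<in> S \<Longrightarrow> (f has_derivative f' x) (at x)"
    and C1: "\<And>v. Ck_on 1 S (\<lambda>x. f' x v)"
    by (subst (asm) Ck_on.simps) blast
  have "\<exists>L\<ge>0. \<forall>y\<in>cball x r. \<forall>z\<in>cball x r. norm (f' y i - f' z i) \<le> L * norm (y - z)" for i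
    using Ck_on_1_lipschitz[OF C1[of i] sub] by metis
  then obtain L where L: "\<And>i. L i \<ge> 0"
    "\<And>i y z. y \<in> cball x r \<Longrightarrow> z \<in> cball x r \<Longrightarrow> norm (f' y i - f' z i) \<le> L i * norm (y - z)"
    by metis
  define K where "K = (\<Sum>i\<in>Basis. L i)"
  define M where "M = (\<Sum>i\<in>Basis. norm (f' x i)) + K * r"
  have K: "K \<ge> 0" by (simp add: K_def L(1) sum_nonneg)
  have lin: "bounded_linear (f' y)" if "y \<in> cball x r" for y
    using that sub f' has_derivative_bounded_linear by blast
  have lip: "norm (f' y v - f' z v) \<le> K * norm (y - z) * norm v"
    if y: "y \<in> cball x r" and z: "z \<in> cball x r" for y z v
  proof -
    have "norm (f' y v - f' z v) \<le> (\<Sum>i\<in>Basis. norm (f' y i - f' z i)) * norm v"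
      using bounded_linear_norm_le_Basis[OF bounded_linear_sub[OF lin[OF y] lin[OF z]]] .
    also have "\<dots> \<le> (\<Sum>i\<in>Basis. L i * norm (y - z)) * norm v"
      by (intro mult_right_mono sum_mono L y z) auto
    finally show ?thesis by (simp add: K_def sum_distrib_right)
  qed
  have "norm (f' y v) \<le> M * norm v" if y: "y \<in> cball x r" for y v
  proof -
    have x: "x \<in> cball x r" using r by simp
    have "norm (f' y v) \<le> norm (f' x v) + norm (f' y v - f' x v)"
      using norm_triangle_sub by blast
    also have "norm (f' x v) \<le> (\<Sum>i\<in>Basis. norm (f' x i)) * norm v"
      by (rule bounded_linear_norm_le_Basis[OF lin[OF x]])
    also have "norm (f' y v - f' x v) \<le> K * norm (y - x) * norm v"
      by (rule lip[OF y x])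
    also have "\<dots> \<le> K * r * norm v"
      using y K by (intro mult_right_mono mult_left_mono) (auto simp: dist_norm norm_minus_commute)
    finally show ?thesis by (simp add: M_def distrib_right)
  qed
  moreover have "M \<ge> 0" unfolding M_def using K r by (simp add: sum_nonneg)
  ultimately show thesis using that[of K M f'] K f' lip by blast
qed

text \<open>\<open>C1_dini_on\<close> controls \<open>h'\<close> along basis vectors other than
  \<open>b\<close>, so the estimates are for \<open>v\<close> orthogonal to \<open>b\<close>, whose
  expansion omits \<open>b\<close>. The moduli of the partial derivatives add up to one
  modulus.\<close>

lemma C1_dini_on_derivative:
  fixes D :: "'a::euclidean_space set"
  assumes "C1_dini_on b D h" and b: "b \<in> Basis" and u0: "u\<^sub>0 \<in> D"
  obtains h' \<epsilon> \<psi> M where "0 < \<epsilon>" "dini_modulus \<psi>" "0 \<le> M"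
    "\<And>x. x \<in> D \<Longrightarrow> (h has_derivative h' x) (at x within D)"
    "\<And>x y v. x \<in> D \<Longrightarrow> y \<in> D \<Longrightarrow> v \<bullet> b = 0 \<Longrightarrow> norm (x - y) < \<epsilon> \<Longrightarrow>
      \<bar>h' x v - h' y v\<bar> \<le> norm v * \<psi> (norm (x - y))"
    "\<And>x v. x \<in> D \<Longrightarrow> v \<bullet> b = 0 \<Longrightarrow> norm (x - u\<^sub>0) < \<epsilon> \<Longrightarrow> \<bar>h' x v\<bar> \<le> M * norm v"
proof -
  obtain h' where h': "\<And>x. x \<in> D \<Longrightarrow> (h has_derivative h' x) (at x within D)"
    and dini: "\<And>i. i \<in> Basis - {b} \<Longrightarrow> dini_continuous_on D (\<lambda>x. h' x i)"
    using assms(1) unfolding C1_dini_on_def by blast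
  have "\<exists>\<epsilon> \<psi>. 0 < \<epsilon> \<and> dini_modulus \<psi> \<and>
      (\<forall>x\<in>D. \<forall>y\<in>D. norm (x - y) < \<epsilon> \<longrightarrow> \<bar>h' x i - h' y i\<bar> \<le> \<psi> (norm (x - y)))"
    if "i \<in> Basis - {b}" for i
    using dini_continuous_on_modulus[OF dini[OF that]] by metis
  then obtain e p where e: "\<And>i. i \<in> Basis - {b} \<Longrightarrow> 0 < e i"
    and p: "\<And>i. i \<in> Basis - {b} \<Longrightarrow> dini_modulus (p i)"
    and ep: "\<And>i x y. i \<in> Basis - {b} \<Longrightarrow> x \<in> D \<Longrightarrow> y \<in> D \<Longrightarrow> norm (x - y) < e i \<Longrightarrow>
      \<bar>h' x i - h' y i\<bar> \<le> p i (norm (x - y))"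
    by metis
  \<comment> \<open>The element 1 keeps \<open>Min\<close> meaningful when \<open>b\<close> is the
    only basis vector.\<close>
  define \<epsilon> where "\<epsilon> = Min (insert 1 (e ` (Basis - {b})))"
  define \<psi> where "\<psi> t = (\<Sum>i\<in>Basis - {b}. p i t)" for t
  define M where "M = (\<Sum>i\<in>Basis. norm (h' u\<^sub>0 i)) + \<psi> \<epsilon>"
  have \<epsilon>: "\<epsilon> > 0" "\<And>i. i \<in> Basis - {b} \<Longrightarrow> \<epsilon> \<le> e i"
    using e by (auto simp: \<epsilon>_def)
  have \<psi>: "dini_modulus \<psi>"
    unfolding \<psi>_def[abs_def] using p by (intro dini_modulus_sum) auto
  have lin: "bounded_linear (h' x)" if "x \<in> D" for x
    using h'[OF that] by (rule has_derivative_bounded_linear)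
  have diff: "\<bar>h' x v - h' y v\<bar> \<le> norm v * \<psi> (norm (x - y))"
    if x: "x \<in> D" and y: "y \<in> D" and v: "v \<bullet> b = 0" and xy: "norm (x - y) < \<epsilon>" for x y v
  proof -
    interpret g: bounded_linear "\<lambda>v. h' x v - h' y v"
      using bounded_linear_sub[OF lin[OF x] lin[OF y]] .
    have "h' x v - h' y v = (\<Sum>i\<in>Basis. (v \<bullet> i) * (h' x i - h' y i))"
      using g.sum[of "\<lambda>i. (v \<bullet> i) *\<^sub>R i" Basis] by (simp add: euclidean_representation g.scaleR)
    also have "\<dots> = (\<Sum>i\<in>Basis - {b}. (v \<bullet> i) * (h' x i - h' y i))"
      using v by (intro sum.mono_neutral_right) auto
    also have "\<bar>\<dots>\<bar> \<le> (\<Sum>i\<in>Basis - {b}. norm v * p i (norm (x - y)))"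
    proof (rule sum_abs[THEN order_trans], rule sum_mono)
      fix i assume i: "i \<in> Basis - {b}"
      show "\<bar>(v \<bullet> i) * (h' x i - h' y i)\<bar> \<le> norm v * p i (norm (x - y))"
        unfolding abs_mult using i x y xy \<epsilon>(2)[OF i]
        by (intro mult_mono ep Basis_le_norm) auto
    qed
    finally show ?thesis by (simp add: \<psi>_def sum_distrib_left)
  qed
  have "\<bar>h' x v\<bar> \<le> M * norm v" if x: "x \<in> D" and v: "v \<bullet> b = 0" and xu: "norm (x - u\<^sub>0) < \<epsilon>" for x v
  proof -
    have "\<bar>h' x v\<bar> \<le> \<bar>h' u\<^sub>0 v\<bar> + \<bar>h' x v - h' u\<^sub>0 v\<bar>" by linarith
    also have "\<bar>h' u\<^sub>0 v\<bar> \<le> (\<Sum>i\<in>Basis. norm (h' u\<^sub>0 i)) * norm v"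
      using bounded_linear_norm_le_Basis[OF lin[OF u0], of v] by simp
    also have "\<bar>h' x v - h' u\<^sub>0 v\<bar> \<le> norm v * \<psi> (norm (x - u\<^sub>0))"
      by (rule diff[OF x u0 v xu])
    also have "\<dots> \<le> norm v * \<psi> \<epsilon>"
      using xu by (intro mult_left_mono dini_modulus_mono[OF \<psi>]) auto
    finally show ?thesis by (simp add: M_def algebra_simps)
  qed
  moreover have "M \<ge> 0"
    unfolding M_def using \<epsilon>(1) by (intro add_nonneg_nonneg sum_nonneg dini_modulus_nonneg[OF \<psi>]) auto
  ultimately show thesis using that[of \<epsilon> \<psi> M h'] \<epsilon>(1) \<psi> h' diff by blast
qed

text \<open>A point \<open>\<xi>\<close> of \<open>S\<close> with supporting direction \<open>\<nu>\<close> minimises \<open>x \<mapsto> (x - \<xi>) \<bullet> \<nu>\<close> on \<open>S\<close>, so along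
  any curve through \<open>\<xi>\<close> in the parametrisation of \<open>S\<close> the derivative of that function vanishes at
  \<open>\<xi>\<close>; its growth is then controlled by the modulus of continuity of the derivative.\<close>
lemma graph_chart_flatness:
  fixes S :: "'a::euclidean_space set"
  assumes \<xi>\<^sub>0: "\<xi>\<^sub>0 \<in> S" "\<xi>\<^sub>0 \<in> U" and chart: "coordinate_chart U V T" and b: "b \<in> Basis"
    and D: "openin (top_of_set (coordinate_hyperplane b)) D" and h: "C1_dini_on b D h"
    and graph: "T ` (S \<inter> U) = {x + h x *\<^sub>R b | x. x \<in> D} \<inter> V"
  obtains r \<psi> where "0 < r" "dini_modulus \<psi>"
    "\<And>\<xi> y \<nu>. \<xi> \<in> S \<Longrightarrow> y \<in> S \<Longrightarrow> dist \<xi>\<^sub>0 \<xi> < r \<Longrightarrow> dist \<xi>\<^sub>0 y < r \<Longrightarrow> norm \<nu> = 1 \<Longrightarrow>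
      \<forall>x\<in>S. 0 \<le> (x - \<xi>) \<bullet> \<nu> \<Longrightarrow> (y - \<xi>) \<bullet> \<nu> \<le> norm (y - \<xi>) * \<psi> (norm (y - \<xi>))"
proof -
  obtain T' where UV: "open U" "open V" and hom: "homeomorphism U V T T'"
    and CkT: "\<And>k. Ck_on k U T" and CkT': "\<And>k. Ck_on k V T'"
    using chart unfolding coordinate_chart_def by blast
  have T'T: "\<And>x. x \<in> U \<Longrightarrow> T' (T x) = x"
    using hom by (simp add: homeomorphism_def)
  have DH: "D \<subseteq> coordinate_hyperplane b" using D openin_imp_subset by blast
  have Db: "u \<bullet> b = 0" if "u \<in> D" for u
    using DH that by (auto simp: coordinate_hyperplane_def)
  have param: "\<exists>u\<in>D. T x = u + h u *\<^sub>R b" if "x \<in> S" "x \<in> U" for x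
    using graph that by blast
  have param_in: "T' (u + h u *\<^sub>R b) \<in> S" if "u \<in> D" "u + h u *\<^sub>R b \<in> V" for u
  proof -
    have "u + h u *\<^sub>R b \<in> T ` (S \<inter> U)" using graph that by blast
    then show ?thesis using T'T by auto
  qed
  obtain u\<^sub>0 where u0: "u\<^sub>0 \<in> D" "T \<xi>\<^sub>0 = u\<^sub>0 + h u\<^sub>0 *\<^sub>R b"
    using param[OF \<xi>\<^sub>0] by blast
  obtain r1 where r1: "r1 > 0" "cball \<xi>\<^sub>0 r1 \<subseteq> U"
    using UV(1) \<xi>\<^sub>0(2) open_contains_cball by blast
  obtain L where L: "L \<ge> 0"
    "\<And>y z. y \<in> cball \<xi>\<^sub>0 r1 \<Longrightarrow> z \<in> cball \<xi>\<^sub>0 r1 \<Longrightarrow> norm (T y - T z) \<le> L * norm (y - z)"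
    using Ck_on_1_lipschitz[OF CkT r1(2)] by blast
  have "T \<xi>\<^sub>0 \<in> V" using hom \<xi>\<^sub>0(2) by (auto simp: homeomorphism_def)
  then obtain R where R: "R > 0" "cball (T \<xi>\<^sub>0) R \<subseteq> V"
    using UV(2) open_contains_cball by blast
  \<comment> \<open>Second derivatives of the inverse chart make \<open>T''\<close> Lipschitz, so
    the chart contributes only a linear term to the modulus.\<close>
  obtain T'' K M where K: "K \<ge> 0" and M: "M \<ge> 0"
    and dT': "\<And>x. x \<in> V \<Longrightarrow> (T' has_derivative T'' x) (at x)"
    and T''M: "\<And>y v. y \<in> cball (T \<xi>\<^sub>0) R \<Longrightarrow> norm (T'' y v) \<le> M * norm v"
    and T''K: "\<And>y z v. y \<in> cball (T \<xi>\<^sub>0) R \<Longrightarrow> z \<in> cball (T \<xi>\<^sub>0) R \<Longrightarrow>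
      norm (T'' y v - T'' z v) \<le> K * norm (y - z) * norm v"
    using Ck_on_2_derivative_lipschitz[OF CkT' R(2)] R(1) by (metis less_imp_le)
  obtain h' \<epsilon> p Mh where \<epsilon>: "\<epsilon> > 0" and p: "dini_modulus p" and Mh: "Mh \<ge> 0"
    and dh: "\<And>x. x \<in> D \<Longrightarrow> (h has_derivative h' x) (at x within D)"
    and h'p: "\<And>x y v. x \<in> D \<Longrightarrow> y \<in> D \<Longrightarrow> v \<bullet> b = 0 \<Longrightarrow> norm (x - y) < \<epsilon> \<Longrightarrow>
      \<bar>h' x v - h' y v\<bar> \<le> norm v * p (norm (x - y))"
    and h'M: "\<And>x v. x \<in> D \<Longrightarrow> v \<bullet> b = 0 \<Longrightarrow> norm (x - u\<^sub>0) < \<epsilon> \<Longrightarrow> \<bar>h' x v\<bar> \<le> Mh * norm v"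
    by (rule C1_dini_on_derivative[OF h b u0(1)]) (rule that; (assumption | blast))
  obtain e1 where e1: "e1 > 0" "ball u\<^sub>0 e1 \<inter> coordinate_hyperplane b \<subseteq> D"
    using D u0(1) unfolding openin_contains_ball by blast
  have "continuous (at u\<^sub>0 within D) (\<lambda>u. u + h u *\<^sub>R b)"
    using has_derivative_continuous[OF dh[OF u0(1)]] by (intro continuous_intros)
  then obtain e2 where e2: "e2 > 0"
    "\<And>u. u \<in> D \<Longrightarrow> dist u u\<^sub>0 < e2 \<Longrightarrow> dist (u + h u *\<^sub>R b) (T \<xi>\<^sub>0) < R"
    using R(1) unfolding continuous_within_eps_delta u0(2) by blast
  \<comment> \<open>The half of \<open>\<epsilon>\<close> prepares for
    \<open>norm w < 2 * e\<close>, which must stay within \<open>\<epsilon>\<close>.\<close>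
  define e where "e = min (\<epsilon> / 2) (min e1 e2)"
  have e: "e > 0" "e \<le> \<epsilon> / 2" "e \<le> e1" "e \<le> e2"
    using \<epsilon> e1 e2 by (auto simp: e_def)
  \<comment> \<open>Dividing by \<open>L + 1\<close> instead of \<open>L\<close> covers
    \<open>L = 0\<close> and makes the bound on the parameters strict.\<close>
  define r where "r = min r1 (e / (L + 1))"
  have r: "r > 0" "r \<le> r1" "(L + 1) * r \<le> e"
  proof -
    show "r > 0" "r \<le> r1" using r1 e L(1) by (simp_all add: r_def)
    have "(L + 1) * r \<le> (L + 1) * (e / (L + 1))"
      using L(1) by (intro mult_left_mono) (simp_all add: r_def)
    then show "(L + 1) * r \<le> e" using L(1) by simp
  qed
  \<comment> \<open>Read off from the final estimate: the linear part pays for moving the base point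
    of \<open>T''\<close>, the part with \<open>p\<close> for the oscillation of
    \<open>h'\<close>.\<close>
  define \<psi> where "\<psi> t = L * (K * (1 + Mh)\<^sup>2 * (L * t) + M * p (L * t))" for t
  have \<psi>: "dini_modulus \<psi>"
  proof -
    have "dini_modulus (\<lambda>t. K * (1 + Mh)\<^sup>2 * (L * t) + M * p (L * t))"
      using K M L(1) p by (intro dini_modulus_add dini_modulus_cmult dini_modulus_scale dini_modulus_ident) auto
    then show ?thesis
      unfolding \<psi>_def[abs_def] by (rule dini_modulus_cmult) (rule L(1))
  qed
  show thesis
  proof (rule that[OF r(1) \<psi>])
    fix \<xi> y \<nu>
    assume \<xi>: "\<xi> \<in> S" "dist \<xi>\<^sub>0 \<xi> < r" and y: "y \<in> S" "dist \<xi>\<^sub>0 y < r" and \<nu>: "norm \<nu> = 1"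
      and supp: "\<forall>x\<in>S. 0 \<le> (x - \<xi>) \<bullet> \<nu>"
    have cb: "\<xi>\<^sub>0 \<in> cball \<xi>\<^sub>0 r1" "\<xi> \<in> cball \<xi>\<^sub>0 r1" "y \<in> cball \<xi>\<^sub>0 r1"
      using r r1 \<xi> y by auto
    obtain u where u: "u \<in> D" "T \<xi> = u + h u *\<^sub>R b"
      using param \<xi>(1) cb r1(2) by blast
    obtain u' where u': "u' \<in> D" "T y = u' + h u' *\<^sub>R b"
      using param y(1) cb r1(2) by blast
    \<comment> \<open>The parameter is recovered by orthogonal projection along \<open>b\<close>,
      which does not increase distances.\<close>
    have proj: "norm (v - v') \<le> norm ((v + h v *\<^sub>R b) - (v' + h v' *\<^sub>R b))" if "v \<in> D" "v' \<in> D" for v v'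
    proof -
      have "(v - v') \<bullet> b = 0"
        using Db that by (simp add: inner_diff_left)
      then have "norm (v - v') \<le> norm ((v - v') + (h v - h v') *\<^sub>R b)"
        by (rule norm_le_norm_add_orthogonal)
      then show ?thesis by (simp add: algebra_simps)
    qed
    have near: "norm (v - u\<^sub>0) < e" if "v \<in> D" "T x = v + h v *\<^sub>R b" "x \<in> cball \<xi>\<^sub>0 r1" "dist \<xi>\<^sub>0 x < r" for v x
    proof -
      have "norm (v - u\<^sub>0) \<le> norm (T x - T \<xi>\<^sub>0)"
        using proj[OF that(1) u0(1)] that(2) u0(2) by simp
      also have "\<dots> \<le> L * norm (x - \<xi>\<^sub>0)" by (rule L(2)[OF that(3) cb(1)])
      also have "\<dots> \<le> L * r"
        using that(4) L(1) by (intro mult_left_mono) (auto simp: dist_norm norm_minus_commute)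
      also have "\<dots> < (L + 1) * r" using r(1) by simp
      finally show ?thesis using r(3) by simp
    qed
    \<comment> \<open>The segment \<open>\<gamma>\<close> from \<open>u\<close> to \<open>u'\<close>
      lifts to the curve \<open>G\<close> on the graph; \<open>f\<close> is the height of its image
      in \<open>S\<close> over the supporting hyperplane.\<close>
    define w where "w = u' - u"
    define \<gamma> where "\<gamma> s = u + s *\<^sub>R w" for s :: real
    define J where "J = {s. \<gamma> s \<in> ball u\<^sub>0 e}"
    define G where "G s = \<gamma> s + h (\<gamma> s) *\<^sub>R b" for s
    define f where "f s = (T' (G s) - \<xi>) \<bullet> \<nu>" for s
    define k where "k s = h' (\<gamma> s) w" for s
    define f' where "f' s = T'' (G s) (w + k s *\<^sub>R b) \<bullet> \<nu>" for s
    have wb: "w \<bullet> b = 0" using Db[OF u(1)] Db[OF u'(1)] by (simp add: w_def inner_diff_left)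
    have wL: "norm w \<le> L * norm (y - \<xi>)"
      using proj[OF u'(1) u(1)] u(2) u'(2) L(2)[OF cb(3,2)] by (simp add: w_def)
    have we: "norm w < 2 * e"
      using near[OF u cb(2) \<xi>(2)] near[OF u' cb(3) y(2)] norm_triangle_ineq4[of "u' - u\<^sub>0" "u - u\<^sub>0"]
      by (simp add: w_def)
    \<comment> \<open>\<open>J\<close> is an open neighbourhood of \<open>[0, 1]\<close>, so the
      derivative at 0 is two-sided and the minimum of \<open>f\<close> there is interior.\<close>
    have openJ: "open J"
    proof -
      have "J = \<gamma> -` ball u\<^sub>0 e" by (auto simp: J_def)
      moreover have "continuous_on UNIV \<gamma>" unfolding \<gamma>_def by (intro continuous_intros)
      ultimately show ?thesis by (simp add: open_vimage)
    qed
    have J01: "s \<in> J" if "0 \<le> s" "s \<le> 1" for s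
    proof -
      have "u \<in> ball u\<^sub>0 e" "u' \<in> ball u\<^sub>0 e"
        using near[OF u cb(2) \<xi>(2)] near[OF u' cb(3) y(2)] by (auto simp: dist_norm norm_minus_commute)
      moreover have "\<gamma> s = (1 - s) *\<^sub>R u + s *\<^sub>R u'"
        by (simp add: \<gamma>_def w_def algebra_simps)
      ultimately show ?thesis
        unfolding J_def using that convexD_alt[OF convex_ball, of u u\<^sub>0 e u' s] by simp
    qed
    have \<gamma>D: "\<gamma> s \<in> D" "norm (\<gamma> s - u\<^sub>0) < \<epsilon>" if "s \<in> J" for s
    proof -
      have "\<gamma> s \<in> coordinate_hyperplane b"
        using wb Db[OF u(1)] by (simp add: coordinate_hyperplane_def \<gamma>_def inner_add_left)
      moreover have "\<gamma> s \<in> ball u\<^sub>0 e1" "dist u\<^sub>0 (\<gamma> s) < e"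
        using that e by (auto simp: J_def)
      ultimately show "\<gamma> s \<in> D" "norm (\<gamma> s - u\<^sub>0) < \<epsilon>"
        using e1 e \<epsilon> by (auto simp: dist_norm norm_minus_commute)
    qed
    have GR: "G s \<in> cball (T \<xi>\<^sub>0) R" if "s \<in> J" for s
      using e2(2)[OF \<gamma>D(1)[OF that]] that e by (simp add: G_def J_def dist_commute)
    \<comment> \<open>\<open>h\<close> is differentiable relative to \<open>D\<close>; since
      \<open>\<gamma>\<close> stays in \<open>D\<close> over the open set \<open>J\<close>, the
      composite has a full derivative in \<open>s\<close>.\<close>
    have dhg: "((\<lambda>s. h (\<gamma> s)) has_real_derivative k s) (at s)" if s: "s \<in> J" for s
    proof -
      have "(\<gamma> has_derivative (\<lambda>x. x *\<^sub>R w)) (at s within J)"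
        unfolding \<gamma>_def by (auto intro!: derivative_eq_intros)
      moreover have "\<gamma> ` J \<subseteq> D" using \<gamma>D by auto
      ultimately have "((\<lambda>s. h (\<gamma> s)) has_derivative (\<lambda>x. h' (\<gamma> s) (x *\<^sub>R w))) (at s within J)"
        using has_derivative_in_compose[of \<gamma> "\<lambda>x. x *\<^sub>R w" s J h "h' (\<gamma> s)"]
          has_derivative_subset[OF dh[OF \<gamma>D(1)[OF s]]] by blast
      moreover have "(\<lambda>x. h' (\<gamma> s) (x *\<^sub>R w)) = (*) (k s)"
        using linear_scale[OF has_derivative_linear[OF dh[OF \<gamma>D(1)[OF s]]]]
        by (intro ext) (simp add: k_def)
      ultimately show ?thesis
        unfolding has_field_derivative_def using at_within_open[OF s openJ] by simp
    qed
    have df: "(f has_real_derivative f' s) (at s)" if s: "s \<in> J" for s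
    proof -
      have "(\<gamma> has_vector_derivative w) (at s)"
        unfolding \<gamma>_def by (auto intro!: derivative_eq_intros)
      moreover have "((\<lambda>s. h (\<gamma> s) *\<^sub>R b) has_vector_derivative k s *\<^sub>R b) (at s)"
        using dhg[OF s] by (auto intro!: derivative_eq_intros)
      ultimately have "(G has_vector_derivative (w + k s *\<^sub>R b)) (at s)"
        unfolding G_def by (rule has_vector_derivative_add)
      moreover have dT: "(T' has_derivative T'' (G s)) (at (G s))"
        using dT' GR[OF s] R(2) by blast
      ultimately have "((\<lambda>s. T' (G s)) has_derivative (\<lambda>x. T'' (G s) (x *\<^sub>R (w + k s *\<^sub>R b)))) (at s)"
        unfolding has_vector_derivative_def by (rule has_derivative_compose)
      then have "((\<lambda>s. (T' (G s) - \<xi>) \<bullet> \<nu>) has_derivative (\<lambda>x. T'' (G s) (x *\<^sub>R (w + k s *\<^sub>R b)) \<bullet> \<nu>)) (at s)"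
        by (auto intro!: derivative_eq_intros)
      moreover have "T'' (G s) (x *\<^sub>R (w + k s *\<^sub>R b)) \<bullet> \<nu> = f' s * x" for x
        using linear_scale[OF has_derivative_linear[OF dT]] by (simp add: f'_def)
      ultimately show ?thesis
        by (simp add: has_field_derivative_def f_def[abs_def])
    qed
    have f0: "f 0 = 0" and f1: "f 1 = (y - \<xi>) \<bullet> \<nu>"
    proof -
      have "T' (u + h u *\<^sub>R b) = \<xi>" "T' (u' + h u' *\<^sub>R b) = y"
        unfolding u(2)[symmetric] u'(2)[symmetric] using cb r1(2) by (auto intro!: T'T)
      then show "f 0 = 0" "f 1 = (y - \<xi>) \<bullet> \<nu>"
        by (simp_all add: f_def G_def \<gamma>_def w_def)
    qed
    have fnn: "f s \<ge> 0" if "s \<in> J" for s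
      using supp param_in[OF \<gamma>D(1)[OF that]] GR[OF that] R(2) by (auto simp: f_def G_def)
    have "0 \<in> J" using J01 by simp
    obtain d where d: "d > 0" "ball 0 d \<subseteq> J"
      using openJ \<open>0 \<in> J\<close> open_contains_ball by blast
    have f'0: "f' 0 = 0"
    proof (rule DERIV_local_min[OF df[OF \<open>0 \<in> J\<close>] d(1)], intro allI impI)
      fix s :: real assume "\<bar>0 - s\<bar> < d"
      then have "s \<in> J" using d(2) by (auto simp: dist_real_def)
      then show "f 0 \<le> f s" using f0 fnn by simp
    qed
    \<comment> \<open>Subtracting \<open>f' 0 = 0\<close> from the mean value \<open>f' z\<close>
      leaves an oscillation of the derivative.\<close>
    obtain z where z: "0 < z" "z < 1" "f 1 - f 0 = f' z"
      using MVT2[of 0 1 f f'] df J01 by auto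
    have zJ: "z \<in> J" using J01 z by simp
    have kb: "\<bar>k s\<bar> \<le> Mh * norm w" if "s \<in> J" for s
      unfolding k_def by (rule h'M[OF \<gamma>D(1)[OF that] wb \<gamma>D(2)[OF that]])
    have hdiff: "\<bar>h (\<gamma> z) - h (\<gamma> 0)\<bar> \<le> Mh * norm w"
    proof -
      obtain z' where z': "0 < z'" "z' < z" "h (\<gamma> z) - h (\<gamma> 0) = z * k z'"
        using MVT2[of 0 z "\<lambda>s. h (\<gamma> s)" k] dhg J01 z by auto
      have "\<bar>z * k z'\<bar> \<le> 1 * \<bar>k z'\<bar>"
        unfolding abs_mult using z by (intro mult_right_mono) auto
      then show ?thesis using z' z kb[OF J01[of z']] by simp
    qed
    have Gdiff: "norm (G z - G 0) \<le> (1 + Mh) * norm w"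
    proof -
      have "G z - G 0 = z *\<^sub>R w + (h (\<gamma> z) - h (\<gamma> 0)) *\<^sub>R b"
        by (simp add: G_def \<gamma>_def algebra_simps)
      also have "norm \<dots> \<le> norm (z *\<^sub>R w) + \<bar>h (\<gamma> z) - h (\<gamma> 0)\<bar>"
        using norm_triangle_ineq[of "z *\<^sub>R w" "(h (\<gamma> z) - h (\<gamma> 0)) *\<^sub>R b"] b by simp
      also have "norm (z *\<^sub>R w) \<le> norm w"
        using z by (simp add: mult_left_le_one_le)
      finally show ?thesis using hdiff by (simp add: distrib_right)
    qed
    have kdiff: "\<bar>k z - k 0\<bar> \<le> norm w * p (norm w)"
    proof -
      have nz: "norm (\<gamma> z - \<gamma> 0) \<le> norm w"
        using z by (simp add: \<gamma>_def mult_left_le_one_le)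
      have "\<bar>k z - k 0\<bar> \<le> norm w * p (norm (\<gamma> z - \<gamma> 0))"
        unfolding k_def using nz we e
        by (intro h'p \<gamma>D zJ \<open>0 \<in> J\<close> wb) auto
      also have "\<dots> \<le> norm w * p (norm w)"
        using nz by (intro mult_left_mono dini_modulus_mono[OF p]) auto
      finally show ?thesis .
    qed
    have vec: "norm (w + k z *\<^sub>R b) \<le> (1 + Mh) * norm w"
      using norm_triangle_ineq[of w "k z *\<^sub>R b"] kb[OF zJ] b by (simp add: distrib_right)
    have lin: "linear (T'' (G 0))"
      using dT' GR[OF \<open>0 \<in> J\<close>] R(2) has_derivative_linear by blast
    have "(y - \<xi>) \<bullet> \<nu> = f' z - f' 0" using z(3) f0 f1 f'0 by simp
    also have "\<dots> = (T'' (G z) (w + k z *\<^sub>R b) - T'' (G 0) (w + k 0 *\<^sub>R b)) \<bullet> \<nu>"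
      by (simp add: f'_def inner_diff_left)
    also have "\<dots> \<le> norm (T'' (G z) (w + k z *\<^sub>R b) - T'' (G 0) (w + k 0 *\<^sub>R b))"
      using norm_cauchy_schwarz[of _ \<nu>] \<nu> by (metis mult.right_neutral)
    \<comment> \<open>Separates moving the base point, paid by \<open>K\<close>, from turning the
      tangent direction, paid by \<open>M\<close> and the modulus of \<open>h'\<close>.\<close>
    also have "T'' (G z) (w + k z *\<^sub>R b) - T'' (G 0) (w + k 0 *\<^sub>R b) =
        (T'' (G z) (w + k z *\<^sub>R b) - T'' (G 0) (w + k z *\<^sub>R b)) + T'' (G 0) ((k z - k 0) *\<^sub>R b)"
    proof -
      have "(k z - k 0) *\<^sub>R b = (w + k z *\<^sub>R b) - (w + k 0 *\<^sub>R b)" by (simp add: algebra_simps)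
      then show ?thesis by (simp only: linear_diff[OF lin]) simp
    qed
    also have "norm \<dots> \<le> K * norm (G z - G 0) * norm (w + k z *\<^sub>R b) + M * norm ((k z - k 0) *\<^sub>R b)"
      by (intro norm_triangle_mono T''K T''M GR zJ \<open>0 \<in> J\<close>)
    also have "\<dots> \<le> K * ((1 + Mh) * norm w) * ((1 + Mh) * norm w) + M * (norm w * p (norm w))"
      using Gdiff vec kdiff K M Mh b by (intro add_mono mult_mono mult_left_mono) auto
    also have "\<dots> = norm w * (K * (1 + Mh)\<^sup>2 * norm w + M * p (norm w))"
      by (simp add: power2_eq_square algebra_simps)
    also have "\<dots> \<le> (L * norm (y - \<xi>)) * (K * (1 + Mh)\<^sup>2 * (L * norm (y - \<xi>)) + M * p (L * norm (y - \<xi>)))"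
      using wL K M L(1) dini_modulus_nonneg[OF p]
      by (intro mult_mono add_mono mult_left_mono dini_modulus_mono[OF p]) auto
    also have "\<dots> = norm (y - \<xi>) * \<psi> (norm (y - \<xi>))"
      by (simp add: \<psi>_def)
    finally show "(y - \<xi>) \<bullet> \<nu> \<le> norm (y - \<xi>) * \<psi> (norm (y - \<xi>))" .
  qed
qed

text \<open>Compactness of the frontier makes the local radii and moduli uniform: a finite sum of
  moduli is again one and dominates each summand.\<close>

lemma frontier_flatness:
  fixes \<Omega> :: "(complex ^ 'n) set"
  assumes "bounded \<Omega>" and C1: "C1_dini_boundary \<Omega>"
  obtains r \<psi> where "0 < r" "dini_modulus \<psi>"
    "\<And>\<xi> y \<nu>. \<xi> \<in> frontier \<Omega> \<Longrightarrow> y \<in> frontier \<Omega> \<Longrightarrow> norm (y - \<xi>) < r \<Longrightarrow> norm \<nu> = 1 \<Longrightarrow>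
      \<forall>x\<in>frontier \<Omega>. 0 \<le> (x - \<xi>) \<bullet> \<nu> \<Longrightarrow> (y - \<xi>) \<bullet> \<nu> \<le> norm (y - \<xi>) * \<psi> (norm (y - \<xi>))"
proof -
  have comp: "compact (frontier \<Omega>)"
    using assms(1) by (rule compact_frontier_bounded)
  define P where "P \<xi>\<^sub>0 r \<psi> \<longleftrightarrow> 0 < r \<and> dini_modulus \<psi> \<and>
      (\<forall>\<xi> y \<nu>. \<xi> \<in> frontier \<Omega> \<longrightarrow> y \<in> frontier \<Omega> \<longrightarrow> dist \<xi>\<^sub>0 \<xi> < r \<longrightarrow> dist \<xi>\<^sub>0 y < r \<longrightarrow>
        norm \<nu> = 1 \<longrightarrow> (\<forall>x\<in>frontier \<Omega>. 0 \<le> (x - \<xi>) \<bullet> \<nu>) \<longrightarrow>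
        (y - \<xi>) \<bullet> \<nu> \<le> norm (y - \<xi>) * \<psi> (norm (y - \<xi>)))"
    for \<xi>\<^sub>0 :: "complex ^ 'n" and r :: real and \<psi> :: "real \<Rightarrow> real"
  have "\<exists>r \<psi>. P \<xi>\<^sub>0 r \<psi>" if \<xi>\<^sub>0: "\<xi>\<^sub>0 \<in> frontier \<Omega>" for \<xi>\<^sub>0
  proof -
    obtain U V T b D h where "\<xi>\<^sub>0 \<in> U" "coordinate_chart U V T" "b \<in> Basis"
      "openin (top_of_set (coordinate_hyperplane b)) D" "C1_dini_on b D h"
      "T ` (frontier \<Omega> \<inter> U) = {x + h x *\<^sub>R b | x. x \<in> D} \<inter> V"
      using C1 \<xi>\<^sub>0 unfolding C1_dini_boundary_def by meson
    from graph_chart_flatness[OF \<xi>\<^sub>0 this] show ?thesis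
      unfolding P_def by metis
  qed
  then obtain \<rho> \<phi> where P: "\<And>\<xi>. \<xi> \<in> frontier \<Omega> \<Longrightarrow> P \<xi> (\<rho> \<xi>) (\<phi> \<xi>)"
    by metis
  then have \<rho>: "\<xi> \<in> frontier \<Omega> \<Longrightarrow> \<rho> \<xi> > 0" for \<xi> by (simp add: P_def)
  \<comment> \<open>Half radii leave room: a point within \<open>r\<close> of a point in a half ball
    lies in the full ball.\<close>
  obtain I where I: "I \<subseteq> frontier \<Omega>" "finite I" "frontier \<Omega> \<subseteq> (\<Union>\<xi>\<in>I. ball \<xi> (\<rho> \<xi> / 2))"
  proof (rule compactE_image[OF comp, of "frontier \<Omega>" "\<lambda>\<xi>. ball \<xi> (\<rho> \<xi> / 2)"])
    show "frontier \<Omega> \<subseteq> (\<Union>\<xi>\<in>frontier \<Omega>. ball \<xi> (\<rho> \<xi> / 2))"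
      using \<rho> by (auto intro!: bexI)
  qed auto
  define r where "r = Min (insert 1 ((\<lambda>\<xi>. \<rho> \<xi> / 2) ` I))"
  define \<psi> where "\<psi> t = (\<Sum>\<xi>\<in>I. \<phi> \<xi> t)" for t
  have r: "r > 0" "\<And>\<xi>. \<xi> \<in> I \<Longrightarrow> r \<le> \<rho> \<xi> / 2"
  proof -
    show "r > 0" using I \<rho> by (auto simp: r_def)
    show "r \<le> \<rho> \<xi> / 2" if "\<xi> \<in> I" for \<xi>
      unfolding r_def using I(2) that by (intro Min_le) auto
  qed
  have \<phi>: "dini_modulus (\<phi> \<xi>)" if "\<xi> \<in> I" for \<xi>
    using P that I(1) by (auto simp: P_def)
  have "dini_modulus \<psi>"
    unfolding \<psi>_def[abs_def] by (rule dini_modulus_sum[OF I(2) \<phi>])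
  with r(1) show thesis
  proof (rule that)
    fix \<xi> y \<nu>
    assume \<xi>: "\<xi> \<in> frontier \<Omega>" and y: "y \<in> frontier \<Omega>" "norm (y - \<xi>) < r" and \<nu>: "norm \<nu> = 1"
      "\<forall>x\<in>frontier \<Omega>. 0 \<le> (x - \<xi>) \<bullet> \<nu>"
    obtain \<eta> where \<eta>: "\<eta> \<in> I" "dist \<eta> \<xi> < \<rho> \<eta> / 2"
      using \<xi> I(3) by auto
    have "dist \<eta> y \<le> dist \<eta> \<xi> + dist \<xi> y" by (rule dist_triangle)
    moreover have "dist \<xi> y < \<rho> \<eta> / 2"
      using y(2) r(2)[OF \<eta>(1)] by (simp add: dist_norm norm_minus_commute)
    moreover have "0 \<le> dist \<eta> \<xi>" by (rule zero_le_dist)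
    ultimately have "dist \<eta> y < \<rho> \<eta>" "dist \<eta> \<xi> < \<rho> \<eta>"
      using \<eta>(2) by (linarith+)
    moreover have "P \<eta> (\<rho> \<eta>) (\<phi> \<eta>)" using P \<eta>(1) I(1) by auto
    ultimately have "(y - \<xi>) \<bullet> \<nu> \<le> norm (y - \<xi>) * \<phi> \<eta> (norm (y - \<xi>))"
      using \<xi> y(1) \<nu> unfolding P_def by blast
    also have "\<dots> \<le> norm (y - \<xi>) * \<psi> (norm (y - \<xi>))"
      unfolding \<psi>_def using I(2) \<eta>(1) dini_modulus_nonneg[OF \<phi>]
      by (intro mult_left_mono member_le_sum) auto
    finally show "(y - \<xi>) \<bullet> \<nu> \<le> norm (y - \<xi>) * \<psi> (norm (y - \<xi>))" .
  qed
qed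

section \<open>From the frontier to the convex domain\<close>

lemma halfspace_closure:
  fixes \<nu> :: "'a::real_inner"
  assumes "\<And>x. x \<in> S \<Longrightarrow> 0 \<le> (x - \<xi>) \<bullet> \<nu>" "x \<in> closure S"
  shows "0 \<le> (x - \<xi>) \<bullet> \<nu>"
proof -
  have "closure S \<subseteq> {x. \<nu> \<bullet> x \<ge> \<nu> \<bullet> \<xi>}"
    using assms(1) by (intro closure_minimal closed_halfspace_ge)
      (auto simp: inner_diff_left inner_commute[of \<nu>])
  then show ?thesis
    using assms(2) by (auto simp: inner_diff_left inner_commute[of \<nu>])
qed

text \<open>If \<open>x\<close> were outside \<open>\<Omega>\<close>, the segment from \<open>x\<close> to a point of \<open>\<Omega>\<close> well inside, at comparable
  distance from \<open>\<xi>\<close>, would cross the frontier too far above the supporting hyperplane at \<open>\<xi>\<close>.\<close>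
lemma convex_contains_cusp:
  fixes \<Omega> :: "'a::euclidean_space set"
  assumes \<Omega>: "open \<Omega>" "convex \<Omega>" "bounded \<Omega>" "z\<^sub>0 \<in> \<Omega>" and r: "0 < r" and \<psi>: "dini_modulus \<psi>"
    and flat: "\<And>\<xi> y \<nu>. \<xi> \<in> frontier \<Omega> \<Longrightarrow> y \<in> frontier \<Omega> \<Longrightarrow> norm (y - \<xi>) < r \<Longrightarrow> norm \<nu> = 1 \<Longrightarrow>
      \<forall>x\<in>frontier \<Omega>. 0 \<le> (x - \<xi>) \<bullet> \<nu> \<Longrightarrow> (y - \<xi>) \<bullet> \<nu> \<le> norm (y - \<xi>) * \<psi> (norm (y - \<xi>))"
  obtains r' where "0 < r'"
    "\<And>\<xi> \<nu> x. \<xi> \<in> frontier \<Omega> \<Longrightarrow> norm \<nu> = 1 \<Longrightarrow> \<forall>x\<in>\<Omega>. 0 \<le> (x - \<xi>) \<bullet> \<nu> \<Longrightarrow>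
      norm (x - \<xi>) < r' \<Longrightarrow> norm (x - \<xi>) * \<psi> (norm (x - \<xi>)) < (x - \<xi>) \<bullet> \<nu> \<Longrightarrow> x \<in> \<Omega>"
proof -
  obtain \<kappa> where \<kappa>: "\<kappa> > 0" "cball z\<^sub>0 \<kappa> \<subseteq> \<Omega>"
    using \<Omega> open_contains_cball by blast
  have "bounded (closure \<Omega>)" using \<Omega>(3) by (rule bounded_closure)
  define B where "B = diameter (closure \<Omega>) + 1"
  have B: "B > 0" "\<And>x y. x \<in> closure \<Omega> \<Longrightarrow> y \<in> closure \<Omega> \<Longrightarrow> norm (x - y) \<le> B"
  proof -
    show "B > 0" using diameter_ge_0[OF \<open>bounded (closure \<Omega>)\<close>] by (simp add: B_def)
    show "norm (x - y) \<le> B" if "x \<in> closure \<Omega>" "y \<in> closure \<Omega>" for x y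
      using diameter_bounded_bound[OF \<open>bounded (closure \<Omega>)\<close> that] by (simp add: B_def dist_norm)
  qed
  \<comment> \<open>Below \<open>\<delta>\<close> the cusp condition asks for less than the slope
    \<open>\<kappa> / B\<close>, and the segment from \<open>\<xi>\<close> to
    \<open>z\<^sub>0\<close> has at least this slope.\<close>
  obtain \<delta> where \<delta>: "\<delta> > 0" "\<And>t. 0 \<le> t \<Longrightarrow> t \<le> \<delta> \<Longrightarrow> \<psi> t < \<kappa> / B"
    using dini_modulus_small[OF \<psi>, of "\<kappa> / B"] \<kappa> B(1) by auto
  define r' where "r' = min r (min \<delta> B)"
  have r': "r' > 0" "r' \<le> r" "r' \<le> \<delta>" "r' \<le> B" using r \<delta> B by (auto simp: r'_def)
  show thesis
  proof (rule that[OF r'(1)])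
    fix \<xi> \<nu> x
    assume \<xi>: "\<xi> \<in> frontier \<Omega>" and \<nu>: "norm \<nu> = 1" and "\<forall>x\<in>\<Omega>. 0 \<le> (x - \<xi>) \<bullet> \<nu>"
      and xr: "norm (x - \<xi>) < r'" and cusp: "norm (x - \<xi>) * \<psi> (norm (x - \<xi>)) < (x - \<xi>) \<bullet> \<nu>"
    then have supp: "\<And>x. x \<in> \<Omega> \<Longrightarrow> 0 \<le> (x - \<xi>) \<bullet> \<nu>" by blast
    define \<tau> where "\<tau> = norm (x - \<xi>)"
    have \<tau>: "\<tau> > 0"
      using cusp by (cases "x = \<xi>") (auto simp: \<tau>_def)
    have \<xi>c: "\<xi> \<in> closure \<Omega>" using \<xi> by (simp add: frontier_def)
    have suppF: "\<forall>x\<in>frontier \<Omega>. 0 \<le> (x - \<xi>) \<bullet> \<nu>"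
      using halfspace_closure[OF supp] by (auto simp: frontier_def)
    \<comment> \<open>Support is evaluated at the lowest point
      \<open>z\<^sub>0 - \<kappa> *\<^sub>R \<nu>\<close> of the ball around
      \<open>z\<^sub>0\<close>.\<close>
    have z0\<nu>: "(z\<^sub>0 - \<xi>) \<bullet> \<nu> \<ge> \<kappa>"
    proof -
      have "z\<^sub>0 - \<kappa> *\<^sub>R \<nu> \<in> \<Omega>" using \<kappa> \<nu> by (auto simp: dist_norm intro!: subsetD[OF \<kappa>(2)])
      from supp[OF this] \<nu> show ?thesis
        by (simp add: inner_diff_left dot_square_norm)
    qed
    \<comment> \<open>A point of the segment from \<open>\<xi>\<close> to \<open>z\<^sub>0\<close>
      within \<open>\<tau>\<close> of \<open>\<xi>\<close> and of height at least
      \<open>\<tau> * \<kappa> / B\<close>.\<close>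
    define p where "p = \<xi> + (\<tau> / B) *\<^sub>R (z\<^sub>0 - \<xi>)"
    have ratio: "0 < \<tau> / B" "\<tau> / B < 1"
      using \<tau> B(1) xr r'(4) by (auto simp: \<tau>_def)
    have p\<Omega>: "p \<in> \<Omega>"
    proof -
      have "z\<^sub>0 \<noteq> \<xi>" using \<xi> \<Omega> by (auto simp: frontier_def interior_open)
      moreover have "p = (1 - (1 - \<tau> / B)) *\<^sub>R z\<^sub>0 + (1 - \<tau> / B) *\<^sub>R \<xi>"
        by (simp add: p_def algebra_simps)
      ultimately have "p \<in> open_segment z\<^sub>0 \<xi>"
        unfolding in_segment using ratio by (intro conjI exI[of _ "1 - \<tau> / B"]) auto
      then show ?thesis
        using in_interior_closure_convex_segment[OF \<Omega>(2) _ \<xi>c, of z\<^sub>0] \<Omega> by (auto simp: interior_open)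
    qed
    have p\<tau>: "norm (p - \<xi>) \<le> \<tau>"
    proof -
      have "norm (p - \<xi>) = (\<tau> / B) * norm (z\<^sub>0 - \<xi>)"
        using \<tau> B(1) by (simp add: p_def)
      also have "\<dots> \<le> (\<tau> / B) * B"
        using \<tau> B(1) \<xi>c closure_subset \<Omega>(4) by (intro mult_left_mono B(2)) auto
      finally show ?thesis using B(1) by simp
    qed
    have small: "\<tau> * \<psi> \<tau> < (p - \<xi>) \<bullet> \<nu>"
    proof -
      have "\<tau> * \<psi> \<tau> < \<tau> * (\<kappa> / B)"
        using \<tau> xr r'(3) by (intro mult_strict_left_mono \<delta>(2)) (auto simp: \<tau>_def)
      also have "\<dots> \<le> (\<tau> / B) * ((z\<^sub>0 - \<xi>) \<bullet> \<nu>)"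
        using mult_left_mono[OF z0\<nu>, of "\<tau> / B"] \<tau> B(1) by simp
      finally show ?thesis by (simp add: p_def)
    qed
    show "x \<in> \<Omega>"
    proof (rule ccontr)
      assume "x \<notin> \<Omega>"
      then have "closed_segment p x \<inter> frontier \<Omega> \<noteq> {}"
        using p\<Omega> by (intro connected_Int_frontier) auto
      then obtain y where y: "y \<in> closed_segment p x" "y \<in> frontier \<Omega>" by blast
      \<comment> \<open>Both ends lie in this ball and in the half space above height
        \<open>\<tau> * \<psi> \<tau>\<close>; both sets are convex, so \<open>y\<close> lies in
        them too, contradicting \<open>flat\<close>.\<close>
      have "closed_segment p x \<subseteq> cball \<xi> \<tau>"
        using p\<tau> by (intro closed_segment_subset) (auto simp: \<tau>_def dist_norm norm_minus_commute)
      then have y\<tau>: "norm (y - \<xi>) \<le> \<tau>" using y(1) by (auto simp: dist_norm norm_minus_commute)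
      have "closed_segment p x \<subseteq> {y. \<nu> \<bullet> y > \<nu> \<bullet> \<xi> + \<tau> * \<psi> \<tau>}"
        using small cusp
        by (intro closed_segment_subset convex_halfspace_gt)
          (auto simp: \<tau>_def inner_diff_left inner_commute[of \<nu>])
      then have "\<tau> * \<psi> \<tau> < (y - \<xi>) \<bullet> \<nu>"
        using y(1) by (auto simp: inner_diff_left inner_commute[of \<nu>])
      also have "\<dots> \<le> norm (y - \<xi>) * \<psi> (norm (y - \<xi>))"
        using y\<tau> xr r'(2) by (intro flat[OF \<xi> y(2) _ \<nu> suppF]) (auto simp: \<tau>_def)
      also have "\<dots> \<le> \<tau> * \<psi> \<tau>"
        using y\<tau> \<tau> dini_modulus_nonneg[OF \<psi>] by (intro mult_mono dini_modulus_mono[OF \<psi>]) auto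
      finally show False by simp
    qed
  qed
qed

text \<open>The ball around \<open>z\<close> that reaches the complement at \<open>\<xi>\<close>
  lies in \<open>\<Omega>\<close>, so a supporting hyperplane at \<open>\<xi>\<close> is tangent to
  it and its normal points along \<open>z - \<xi>\<close>.\<close>

lemma nearest_frontier_point:
  fixes \<Omega> :: "'a::euclidean_space set"
  assumes \<Omega>: "open \<Omega>" "convex \<Omega>" "bounded \<Omega>" and z: "z \<in> \<Omega>"
  obtains \<xi> \<nu> where "\<xi> \<in> frontier \<Omega>" "norm \<nu> = 1" "z = \<xi> + infdist z (- \<Omega>) *\<^sub>R \<nu>"
    "\<And>x. x \<in> \<Omega> \<Longrightarrow> 0 \<le> (x - \<xi>) \<bullet> \<nu>"
proof -
  have "- \<Omega> \<noteq> {}" using \<Omega>(3) not_bounded_UNIV by (metis Compl_empty_eq double_compl)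
  then obtain \<xi> where \<xi>: "\<xi> \<in> - \<Omega>" "infdist z (- \<Omega>) = dist z \<xi>"
    using infdist_attains_inf[of "- \<Omega>" z] \<Omega>(1) by (auto simp: closed_def)
  define d where "d = norm (z - \<xi>)"
  have d: "d > 0" using \<xi>(1) z by (auto simp: d_def)
  have sub: "ball z d \<subseteq> \<Omega>"
  proof
    fix x assume "x \<in> ball z d"
    then show "x \<in> \<Omega>"
      using infdist_le[of x "- \<Omega>" z] \<xi>(2) by (auto simp: d_def dist_norm)
  qed
  then have cball: "cball z d \<subseteq> closure \<Omega>"
    using closure_mono[OF sub] d by simp
  then have \<xi>c: "\<xi> \<in> closure \<Omega>"
    by (rule subsetD) (simp add: d_def dist_norm)
  have "\<xi> \<notin> rel_interior \<Omega>"
    using \<xi>(1) rel_interior_subset by auto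
  then obtain a where a: "a \<noteq> 0" "\<And>y. y \<in> closure \<Omega> \<Longrightarrow> a \<bullet> \<xi> \<le> a \<bullet> y"
    using supporting_hyperplane_relative_frontier[OF \<Omega>(2) \<xi>c] by metis
  define \<nu> where "\<nu> = a /\<^sub>R norm a"
  have \<nu>: "norm \<nu> = 1" using a(1) by (simp add: \<nu>_def)
  have supp: "0 \<le> (x - \<xi>) \<bullet> \<nu>" if "x \<in> closure \<Omega>" for x
    using a(2)[OF that] a(1) by (simp add: \<nu>_def inner_diff_left inner_commute[of a])
  \<comment> \<open>Support at the lowest point of the ball yields the equality case of
    Cauchy-Schwarz.\<close>
  have "z - d *\<^sub>R \<nu> \<in> closure \<Omega>"
    using d \<nu> by (intro subsetD[OF cball]) (simp add: dist_norm)
  from supp[OF this] have "d \<le> (z - \<xi>) \<bullet> \<nu>"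
    using \<nu> by (simp add: inner_diff_left dot_square_norm)
  then have "(z - \<xi>) \<bullet> \<nu> = norm (z - \<xi>) * norm \<nu>"
    using norm_cauchy_schwarz[of "z - \<xi>" \<nu>] \<nu> by (simp add: d_def)
  then have "norm (z - \<xi>) *\<^sub>R \<nu> = norm \<nu> *\<^sub>R (z - \<xi>)"
    by (simp add: norm_cauchy_schwarz_eq)
  then have "z = \<xi> + infdist z (- \<Omega>) *\<^sub>R \<nu>"
    using \<nu> \<xi>(2) by (simp add: dist_norm)
  moreover have "\<xi> \<in> frontier \<Omega>"
    using \<xi>(1) \<xi>c \<Omega>(1) by (simp add: frontier_def interior_open)
  ultimately show thesis
    using that \<nu> supp closure_subset by blast
qed

section \<open>Chains of discs\<close>

lemma poincare_dist_nonneg: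
  assumes "a \<in> ball 0 1" "b \<in> ball 0 1"
  shows "0 \<le> poincare_dist a b"
proof -
  \<comment> \<open>The quotient in \<open>poincare_dist\<close> has the modulus of a Moebius map of
    the disc.\<close>
  have "cmod (Moebius_function 0 a b) < 1"
    using assms by (intro Moebius_function_norm_lt_1) auto
  then have r: "cmod ((a - b) / (1 - cnj a * b)) < 1"
    by (simp add: Moebius_function_def norm_divide norm_minus_commute)
  define r where "r = cmod ((a - b) / (1 - cnj a * b))"
  have "0 \<le> r" "r < 1" using r by (simp_all add: r_def)
  then have "1 \<le> (1 + r) / (1 - r)" by simp
  then show ?thesis
    by (simp add: poincare_dist_def Let_def r_def[symmetric])
qed

lemma kobayashi_dist_le:
  assumes "disc_chain \<Omega> z w m \<phi> a b"
  shows "kobayashi_dist \<Omega> z w \<le> (\<Sum>j<m. poincare_dist (a j) (b j))"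
  unfolding kobayashi_dist_def
proof (rule cInf_lower)
  \<comment> \<open>A real \<open>Inf\<close> is known to lie below the members only if the set is
    bounded below; the costs are nonnegative.\<close>
  show "bdd_below {(\<Sum>j<m. poincare_dist (a j) (b j)) | m \<phi> a b. disc_chain \<Omega> z w m \<phi> a b}"
    by (rule bdd_belowI[of _ 0]) (auto simp: disc_chain_def intro!: sum_nonneg poincare_dist_nonneg)
qed (use assms in blast)

lemma disc_chain_snoc:
  assumes "disc_chain \<Omega> z w m \<phi> a b" "analytic_disc \<Omega> f" "\<alpha> \<in> ball 0 1" "\<beta> \<in> ball 0 1"
    "f \<alpha> = w" "f \<beta> = w'"
  shows "disc_chain \<Omega> z w' (Suc m) (\<phi>(m := f)) (a(m := \<alpha>)) (b(m := \<beta>))"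
proof -
  obtain p where p: "p 0 = z" "p m = w"
    "\<forall>j<m. analytic_disc \<Omega> (\<phi> j) \<and> a j \<in> ball 0 1 \<and> b j \<in> ball 0 1 \<and>
      \<phi> j (a j) = p j \<and> \<phi> j (b j) = p (Suc j)"
    using assms(1) unfolding disc_chain_def by blast
  show ?thesis
    unfolding disc_chain_def
  proof (intro exI[of _ "p(Suc m := w')"] conjI allI impI)
    fix j assume "j < Suc m"
    then consider "j < m" | "j = m" by linarith
    note cs = this
    show "analytic_disc \<Omega> ((\<phi>(m := f)) j)" using cs p assms by cases auto
    show "(a(m := \<alpha>)) j \<in> ball 0 1" using cs p assms by cases auto
    show "(b(m := \<beta>)) j \<in> ball 0 1" using cs p assms by cases auto
    show "(\<phi>(m := f)) j ((a(m := \<alpha>)) j) = (p(Suc m := w')) j" using cs p assms by cases auto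
    show "(\<phi>(m := f)) j ((b(m := \<beta>)) j) = (p(Suc m := w')) (Suc j)" using cs p assms by cases auto
  qed (use p in auto)
qed

section \<open>Complex lines and distance to the complement\<close>

lemma norm_vector_scalar_mult: "norm (c *s v) = cmod c * norm (v :: complex ^ 'n)"
  by (simp add: norm_vec_def norm_mult L2_set_right_distrib)

text \<open>The real inner product is the real part of the Hermitian one, so on the complex line
  through \<open>\<xi>\<close> along \<open>\<nu>\<close> the height over the supporting hyperplane
  is the real part of the coordinate.\<close>

lemma inner_vector_scalar_mult: "(c *s v) \<bullet> v = Re c * (norm v)\<^sup>2" for v :: "complex ^ 'n"
proof -
  have "(c *s v) \<bullet> v = (\<Sum>i\<in>UNIV. Re c * (v $ i \<bullet> v $ i))"
    unfolding inner_vec_def by (intro sum.cong) (auto simp: inner_complex_def algebra_simps)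
  also have "\<dots> = Re c * (v \<bullet> v)"
    by (simp add: inner_vec_def sum_distrib_left)
  finally show ?thesis by (simp add: power2_norm_eq_inner)
qed

text \<open>Turns a distance bound into inclusion of a ball, the form in which disc chains are
  built. \<open>infdist\<close> to the empty set is 0, whence the assumption.\<close>

lemma infdist_compl_ge_iff:
  fixes \<Omega> :: "'a::metric_space set"
  assumes "- \<Omega> \<noteq> {}"
  shows "\<kappa> \<le> infdist x (- \<Omega>) \<longleftrightarrow> ball x \<kappa> \<subseteq> \<Omega>"
proof
  assume "\<kappa> \<le> infdist x (- \<Omega>)"
  then show "ball x \<kappa> \<subseteq> \<Omega>"
    using infdist_le[of _ "- \<Omega>" x] by force
next
  assume sub: "ball x \<kappa> \<subseteq> \<Omega>"
  then show "\<kappa> \<le> infdist x (- \<Omega>)"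
    unfolding infdist_notempty[OF assms] by (intro cINF_greatest[OF assms]) (force simp: not_less[symmetric])
qed

text \<open>The segment from \<open>z\<^sub>0\<close> to \<open>w\<close> is covered by a fixed number of Euclidean discs of radius \<open>\<kappa>\<close>,
  the centre of each lying half way to the boundary of the preceding one.\<close>
lemma disc_chain_uniform:
  fixes \<Omega> :: "(complex ^ 'n) set"
  assumes \<Omega>: "open \<Omega>" "convex \<Omega>" "bounded \<Omega>" "z\<^sub>0 \<in> \<Omega>" and \<kappa>: "0 < \<kappa>"
  obtains N where "\<And>w. w \<in> \<Omega> \<Longrightarrow> ball w \<kappa> \<subseteq> \<Omega> \<Longrightarrow>
    \<exists>\<phi>. disc_chain \<Omega> z\<^sub>0 w N \<phi> (\<lambda>_. 0) (\<lambda>_. 1/2)"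
proof -
  obtain e where e: "e > 0" "ball z\<^sub>0 e \<subseteq> \<Omega>"
    using \<Omega> open_contains_ball by blast
  define k where "k = min e \<kappa>"
  have k: "k > 0" "ball z\<^sub>0 k \<subseteq> \<Omega>" using e \<kappa> by (auto simp: k_def)
  obtain B where B: "\<And>x. x \<in> \<Omega> \<Longrightarrow> norm (x - z\<^sub>0) \<le> B"
    using \<Omega>(3) bounded_any_center[of \<Omega> z\<^sub>0] by (auto simp: dist_norm norm_minus_commute)
  \<comment> \<open>The steps then have length at most \<open>k / 2\<close>; the 1 in
    \<open>max\<close> ensures \<open>N > 0\<close>.\<close>
  obtain N :: nat where N: "max 1 (2 * B / k) < N" using reals_Archimedean2 by blast
  have "\<exists>\<phi>. disc_chain \<Omega> z\<^sub>0 w N \<phi> (\<lambda>_. 0) (\<lambda>_. 1/2)" if w: "w \<in> \<Omega>" "ball w \<kappa> \<subseteq> \<Omega>" for w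
  proof -
    define v where "v = (w - z\<^sub>0) /\<^sub>R N"
    define p where "p j = z\<^sub>0 + real j *\<^sub>R v" for j
    \<comment> \<open>The factor 2 puts \<open>p (Suc j)\<close> at \<open>\<zeta> = 1/2\<close>, so
      each disc costs the same whatever \<open>w\<close> is.\<close>
    define \<phi> where "\<phi> j \<zeta> = p j + (2 * \<zeta>) *s v" for j \<zeta>
    have v: "2 * norm v \<le> k"
    proof -
      have "2 * B < k * N" "N > 0" using N k(1) by (auto simp: field_simps)
      then have "2 * norm (w - z\<^sub>0) \<le> k * N" using B[OF w(1)] by linarith
      moreover have "norm v = norm (w - z\<^sub>0) / N"
        unfolding v_def norm_scaleR by (simp add: divide_inverse)
      ultimately show ?thesis using \<open>N > 0\<close> by (simp add: pos_divide_le_eq)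
    qed
    have "analytic_disc \<Omega> (\<phi> j)" if "j < N" for j
      unfolding analytic_disc_def
    proof (intro conjI allI subsetI)
      show "(\<lambda>\<zeta>. \<phi> j \<zeta> $ i) holomorphic_on ball 0 1" for i
        unfolding \<phi>_def by (simp, intro holomorphic_intros)
      fix x assume "x \<in> \<phi> j ` ball 0 1"
      then obtain \<zeta> where \<zeta>: "cmod \<zeta> < 1" "x = \<phi> j \<zeta>" by auto
      define y where "y = (2 * \<zeta>) *s v"
      have y: "norm y < k"
      proof -
        have "norm y = cmod \<zeta> * (2 * norm v)"
          by (simp add: y_def norm_vector_scalar_mult norm_mult del: vector_smult_assoc)
        also have "\<dots> \<le> cmod \<zeta> * k" using v by (intro mult_left_mono) auto
        also have "\<dots> < k" using \<zeta>(1) k(1) by simp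
        finally show ?thesis .
      qed
      have "z\<^sub>0 + y \<in> \<Omega>" using y k(2) by (auto simp: dist_norm intro!: subsetD[OF k(2)])
      moreover have "w + y \<in> \<Omega>"
        using y by (auto simp: dist_norm k_def intro!: subsetD[OF w(2)])
      \<comment> \<open>The same displacement \<open>y\<close> from \<open>z\<^sub>0\<close> and
        from \<open>w\<close> stays in \<open>\<Omega>\<close>, and \<open>x\<close> is a convex
        combination of the two points.\<close>
      ultimately have "(1 - j / N) *\<^sub>R (z\<^sub>0 + y) + (j / N) *\<^sub>R (w + y) \<in> \<Omega>"
        using \<open>j < N\<close> by (intro convexD_alt[OF \<Omega>(2)]) auto
      also have "(1 - j / N) *\<^sub>R (z\<^sub>0 + y) + (j / N) *\<^sub>R (w + y) = x"
        by (simp add: \<zeta>(2) \<phi>_def y_def p_def v_def algebra_simps divide_inverse)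
      finally show "x \<in> \<Omega>" .
    qed
    moreover have "\<phi> j 0 = p j" for j
      by (simp add: \<phi>_def)
    moreover have "\<phi> j (1/2) = p (Suc j)" for j
      by (simp add: \<phi>_def p_def algebra_simps)
    moreover have "p 0 = z\<^sub>0" "p N = w"
      using N by (simp_all add: p_def v_def)
    ultimately have "disc_chain \<Omega> z\<^sub>0 w N \<phi> (\<lambda>_. 0) (\<lambda>_. 1/2)"
      unfolding disc_chain_def by (intro exI[of _ p]) auto
    then show ?thesis by blast
  qed
  then show thesis using that by blast
qed

text \<open>\<open>t / r - 1\<close> is where \<open>\<zeta> \<mapsto> r (1 + \<zeta>)\<close> takes
  the value \<open>t\<close>; its modulus is \<open>1 - t / r\<close>, and the quotient in the
  logarithm becomes \<open>2 * r / t - 1\<close>.\<close>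

lemma poincare_dist_0_shifted:
  assumes "0 < t" "t \<le> r"
  shows "poincare_dist 0 (of_real (t / r - 1)) \<le> 1/2 * ln (2 * r / t)"
proof -
  have "cmod (of_real (t / r - 1)) = 1 - t / r"
    using assms by (simp only: norm_of_real) simp
  then have "poincare_dist 0 (of_real (t / r - 1)) = 1/2 * ln ((1 + (1 - t / r)) / (1 - (1 - t / r)))"
    by (simp only: poincare_dist_0)
  also have "(1 + (1 - t / r)) / (1 - (1 - t / r)) = 2 * r / t - 1"
    using assms by (simp add: field_simps)
  also have "1/2 * ln (2 * r / t - 1) \<le> 1/2 * ln (2 * r / t)"
    using assms by (intro mult_left_mono ln_mono) (auto simp: field_simps)
  finally show ?thesis .
qed

section \<open>Assembling the Kobayashi estimate\<close>

theorem proposition1p5: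
  fixes \<Omega> :: "(complex ^ 'n) set" and z\<^sub>0 :: "complex ^ 'n"
  assumes "open \<Omega>" and "convex \<Omega>" and "bounded \<Omega>"
    and "C1_dini_boundary \<Omega>"
    and "z\<^sub>0 \<in> \<Omega>"
  shows "\<exists>C>0. \<forall>z\<in>\<Omega>.
    kobayashi_dist \<Omega> z\<^sub>0 z \<le> C + 1/2 * ln (1 / infdist z (- \<Omega>))"
proof -
  have ne: "- \<Omega> \<noteq> {}"
    using assms(3) not_bounded_UNIV by (metis Compl_empty_eq double_compl)
  obtain r \<psi> where "0 < r" and \<psi>: "dini_modulus \<psi>"
    and flat: "\<And>\<xi> y \<nu>. \<xi> \<in> frontier \<Omega> \<Longrightarrow> y \<in> frontier \<Omega> \<Longrightarrow> norm (y - \<xi>) < r \<Longrightarrow> norm \<nu> = 1 \<Longrightarrow>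
      \<forall>x\<in>frontier \<Omega>. 0 \<le> (x - \<xi>) \<bullet> \<nu> \<Longrightarrow> (y - \<xi>) \<bullet> \<nu> \<le> norm (y - \<xi>) * \<psi> (norm (y - \<xi>))"
    using frontier_flatness[OF assms(3,4)] by metis
  obtain r' where r': "0 < r'"
    and cusp: "\<And>\<xi> \<nu> x. \<xi> \<in> frontier \<Omega> \<Longrightarrow> norm \<nu> = 1 \<Longrightarrow> \<forall>x\<in>\<Omega>. 0 \<le> (x - \<xi>) \<bullet> \<nu> \<Longrightarrow>
      norm (x - \<xi>) < r' \<Longrightarrow> norm (x - \<xi>) * \<psi> (norm (x - \<xi>)) < (x - \<xi>) \<bullet> \<nu> \<Longrightarrow> x \<in> \<Omega>"
    by (rule convex_contains_cusp[OF assms(1-3,5) \<open>0 < r\<close> \<psi>])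
      ((rule flat; assumption), (rule that; blast))
  obtain \<delta> F where \<delta>: "0 < \<delta>" and hol: "F holomorphic_on {\<zeta>. Re \<zeta> > 0}"
    and F2: "\<And>\<zeta>. Re \<zeta> > 0 \<Longrightarrow> cmod (F \<zeta>) \<le> 2 * cmod \<zeta>"
    and F\<psi>: "\<And>\<zeta>. Re \<zeta> > 0 \<Longrightarrow> cmod \<zeta> < \<delta> \<Longrightarrow> cmod (F \<zeta>) * \<psi> (cmod (F \<zeta>)) < Re (F \<zeta>)"
    and FIm: "\<And>t. t > 0 \<Longrightarrow> Im (F (of_real t)) = 0"
    and FRe: "\<And>t. t > 0 \<Longrightarrow> t \<le> Re (F (of_real t))"
    using half_plane_map[OF \<psi>] by metis
  obtain \<eta> where \<eta>: "\<eta> > 0" "\<And>t. 0 \<le> t \<Longrightarrow> t \<le> \<eta> \<Longrightarrow> \<psi> t < 1/4"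
    using dini_modulus_small[OF \<psi>, of "1/4"] by auto
  \<comment> \<open>The disc feeds \<open>F\<close> arguments of modulus below
    \<open>2 * r0\<close>, hence gives values below \<open>4 * r0\<close>; these stay within
    \<open>\<delta>\<close> and \<open>r'\<close>. The bound by \<open>\<eta>\<close> covers the
    points near \<open>f 0\<close>.\<close>
  define r0 where "r0 = min (\<delta> / 2) (min (r' / 4) (\<eta> / 4))"
  have r0: "r0 > 0" "2 * r0 \<le> \<delta>" "4 * r0 \<le> r'" "4 * r0 \<le> \<eta>"
    using \<delta> r' \<eta>(1) by (auto simp: r0_def)
  obtain N where N: "\<And>w. w \<in> \<Omega> \<Longrightarrow> ball w (r0 / 4) \<subseteq> \<Omega> \<Longrightarrow>
      \<exists>\<phi>. disc_chain \<Omega> z\<^sub>0 w N \<phi> (\<lambda>_. 0) (\<lambda>_. 1/2)"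
    using disc_chain_uniform[OF assms(1-3,5), of "r0 / 4"] r0(1) by auto
  define P where "P = real N * poincare_dist 0 (1/2)"
  have P: "P \<ge> 0"
    unfolding P_def by (intro mult_nonneg_nonneg poincare_dist_nonneg) auto
  obtain q where q: "q \<in> - \<Omega>" using ne by blast
  obtain B where B: "\<And>z. z \<in> \<Omega> \<Longrightarrow> dist q z \<le> B"
    using assms(3) bounded_any_center[of \<Omega> q] by auto
  define D where "D = max B 1"
  have dD: "infdist z (- \<Omega>) \<le> D" and d0: "0 < infdist z (- \<Omega>)" if z: "z \<in> \<Omega>" for z
  proof -
    show "infdist z (- \<Omega>) \<le> D"
      using infdist_le[OF q, of z] B[OF z] by (simp add: D_def dist_commute)
    show "0 < infdist z (- \<Omega>)"
      using z ne assms(1) in_closed_iff_infdist_zero[of "- \<Omega>" z] infdist_nonneg[of z "- \<Omega>"]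
      by (auto simp: closed_def less_le)
  qed
  \<comment> \<open>\<open>ln D\<close> serves points far from the boundary, where the logarithm on
    the right may be negative; \<open>ln (4 * r0)\<close> is the excess cost of the single disc near
    it; the 1 makes \<open>C\<close> positive.\<close>
  define C where "C = 1 + P + 1/2 * \<bar>ln (4 * r0)\<bar> + 1/2 * ln D"
  have lnD: "ln D \<ge> 0" by (simp add: D_def)
  have main: "kobayashi_dist \<Omega> z\<^sub>0 z \<le> C + 1/2 * ln (1 / infdist z (- \<Omega>))" if z: "z \<in> \<Omega>" for z
  proof (cases "r0 / 4 \<le> infdist z (- \<Omega>)")
    case True
    then obtain \<phi> where "disc_chain \<Omega> z\<^sub>0 z N \<phi> (\<lambda>_. 0) (\<lambda>_. 1/2)"
      using N[OF z] infdist_compl_ge_iff[OF ne] by blast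
    from kobayashi_dist_le[OF this] have "kobayashi_dist \<Omega> z\<^sub>0 z \<le> P"
      by (simp add: P_def)
    moreover have "ln (infdist z (- \<Omega>)) \<le> ln D"
      using dD[OF z] d0[OF z] by simp
    then have "1/2 * ln (1 / infdist z (- \<Omega>)) \<ge> - (1/2 * ln D)"
      using d0[OF z] by (simp add: ln_div)
    ultimately show ?thesis by (simp add: C_def)
  next
    case False
    define d where "d = infdist z (- \<Omega>)"
    have d: "d > 0" "d < r0" using d0[OF z] False r0(1) by (auto simp: d_def)
    obtain \<xi> \<nu> where \<xi>: "\<xi> \<in> frontier \<Omega>" and \<nu>: "norm \<nu> = 1" and z\<xi>: "z = \<xi> + d *\<^sub>R \<nu>"
      and supp: "\<forall>x\<in>\<Omega>. 0 \<le> (x - \<xi>) \<bullet> \<nu>"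
      using nearest_frontier_point[OF assms(1-3) z] unfolding d_def by metis
    \<comment> \<open>On the positive axis \<open>t \<le> F t \<le> 2 * t\<close>, so
      \<open>F t = d\<close> has a solution in \<open>[d / 2, d]\<close>.\<close>
    have "continuous_on {d / 2..d} (\<lambda>t. Re (F (of_real t)))"
      using d by (intro continuous_on_Re continuous_on_compose2[OF holomorphic_on_imp_continuous_on[OF hol]]
          continuous_intros) auto
    moreover have "Re (F (of_real (d / 2))) \<le> d"
      using F2[of "of_real (d / 2)"] complex_Re_le_cmod[of "F (of_real (d / 2))"] d by simp
    moreover have "d \<le> Re (F (of_real d))" using FRe d by simp
    ultimately obtain t where t: "d / 2 \<le> t" "t \<le> d" "Re (F (of_real t)) = d"
      using IVT'[of "\<lambda>t. Re (F (of_real t))" "d / 2" d d] d by auto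
    \<comment> \<open>The centre goes to a point at depth comparable to \<open>r0\<close>, and
      \<open>t / r0 - 1\<close> goes to \<open>z\<close>.\<close>
    define f where "f \<zeta> = \<xi> + F (of_real r0 * (1 + \<zeta>)) *s \<nu>" for \<zeta>
    have fn: "norm (f \<zeta> - \<xi>) = cmod (F (of_real r0 * (1 + \<zeta>)))"
      and fi: "(f \<zeta> - \<xi>) \<bullet> \<nu> = Re (F (of_real r0 * (1 + \<zeta>)))" for \<zeta>
      using \<nu> by (simp_all add: f_def norm_vector_scalar_mult inner_vector_scalar_mult)
    have half: "Re (of_real r0 * (1 + \<zeta>)) > 0" "cmod (of_real r0 * (1 + \<zeta>)) < 2 * r0"
      if "cmod \<zeta> < 1" for \<zeta>
    proof -
      have "Re (of_real r0 * (1 + \<zeta>)) = r0 * (1 + Re \<zeta>)" by simp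
      moreover have "- Re \<zeta> < 1" using abs_Re_le_cmod[of \<zeta>] that by linarith
      ultimately show "Re (of_real r0 * (1 + \<zeta>)) > 0"
        using r0(1) by simp
      have "cmod (1 + \<zeta>) < 2" using norm_triangle_ineq[of 1 \<zeta>] that by simp
      then show "cmod (of_real r0 * (1 + \<zeta>)) < 2 * r0"
        using r0(1) by (simp add: norm_mult)
    qed
    have disc: "analytic_disc \<Omega> f"
      unfolding analytic_disc_def
    proof (intro conjI allI subsetI)
      show "(\<lambda>\<zeta>. f \<zeta> $ i) holomorphic_on ball 0 1" for i
      proof -
        have "(\<lambda>\<zeta>. F (of_real r0 * (1 + \<zeta>))) holomorphic_on ball 0 1"
          using half by (intro holomorphic_on_compose_gen[OF _ hol, unfolded o_def] holomorphic_intros) auto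
        then show ?thesis unfolding f_def by (simp, intro holomorphic_intros)
      qed
      fix x assume "x \<in> f ` ball 0 1"
      then obtain \<zeta> where \<zeta>: "cmod \<zeta> < 1" "x = f \<zeta>" by auto
      show "x \<in> \<Omega>"
      proof (rule cusp[OF \<xi> \<nu> supp])
        show "norm (x - \<xi>) < r'"
          unfolding \<zeta>(2) fn using F2[OF half(1)[OF \<zeta>(1)]] half(2)[OF \<zeta>(1)] r0(3) by linarith
        show "norm (x - \<xi>) * \<psi> (norm (x - \<xi>)) < (x - \<xi>) \<bullet> \<nu>"
          unfolding \<zeta>(2) fn fi using F\<psi>[OF half(1)[OF \<zeta>(1)]] half(2)[OF \<zeta>(1)] r0(2) by linarith
      qed
    qed
    have ball: "ball (f 0) (r0 / 4) \<subseteq> \<Omega>"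
    proof
      fix x assume "x \<in> ball (f 0) (r0 / 4)"
      then have x: "norm (x - f 0) < r0 / 4" by (simp add: dist_norm norm_minus_commute)
      define s where "s = Re (F (of_real r0))"
      have s: "r0 \<le> s" using FRe r0(1) by (simp add: s_def)
      have Fs: "F (of_real r0) = of_real s"
        using FIm[OF r0(1)] by (simp add: s_def complex_eq_iff)
      have f0: "norm (f 0 - \<xi>) = s" "(f 0 - \<xi>) \<bullet> \<nu> = s"
        using s r0(1) by (simp_all add: fn fi Fs)
      have s2: "s \<le> 2 * r0" using F2[of "of_real r0"] r0(1) s by (simp add: Fs)
      define \<tau> where "\<tau> = norm (x - \<xi>)"
      have \<tau>: "\<tau> \<le> s + r0 / 4"
        using norm_triangle_ineq[of "f 0 - \<xi>" "x - f 0"] f0(1) x by (simp add: \<tau>_def)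
      have "\<bar>(x - f 0) \<bullet> \<nu>\<bar> \<le> r0 / 4"
        using Cauchy_Schwarz_ineq2[of "x - f 0" \<nu>] \<nu> x by simp
      moreover have "(x - \<xi>) \<bullet> \<nu> = (x - f 0) \<bullet> \<nu> + (f 0 - \<xi>) \<bullet> \<nu>"
        by (simp add: inner_diff_left)
      ultimately have x\<nu>: "s - r0 / 4 \<le> (x - \<xi>) \<bullet> \<nu>" using f0(2) by linarith
      \<comment> \<open>With \<open>\<tau> \<le> s + r0 / 4\<close> and \<open>r0 \<le> s\<close>, a
        quarter of \<open>\<tau>\<close> is less than the height bound
        \<open>s - r0 / 4\<close>.\<close>
      have "\<psi> \<tau> < 1/4" using \<tau> s2 r0 by (intro \<eta>(2)) (auto simp: \<tau>_def)
      then have "\<tau> * \<psi> \<tau> \<le> \<tau> * (1/4)" by (intro mult_left_mono) (auto simp: \<tau>_def)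
      then have "\<tau> * \<psi> \<tau> < (x - \<xi>) \<bullet> \<nu>" using \<tau> x\<nu> s r0(1) by linarith
      moreover have "\<tau> < r'" using \<tau> s2 r0(1,3) by linarith
      ultimately show "x \<in> \<Omega>"
        using cusp[OF \<xi> \<nu> supp] by (simp add: \<tau>_def)
    qed
    have "f 0 \<in> \<Omega>" using ball r0(1) by auto
    then obtain \<phi> where \<phi>: "disc_chain \<Omega> z\<^sub>0 (f 0) N \<phi> (\<lambda>_. 0) (\<lambda>_. 1/2)"
      using N ball by blast
    have t0: "0 < t" "t \<le> r0" using t d by auto
    have \<beta>: "of_real (t / r0 - 1) \<in> ball (0 :: complex) 1"
      using t0 by (simp only: mem_ball dist_0_norm norm_of_real) simp
    have "f (of_real (t / r0 - 1)) = z"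
    proof -
      have "of_real r0 * (1 + of_real (t / r0 - 1)) = (of_real t :: complex)"
        using r0(1) by (simp add: algebra_simps)
      moreover have "F (of_real t) = of_real d"
        using FIm[OF t0(1)] t(3) by (simp add: complex_eq_iff)
      moreover have "of_real d *s \<nu> = d *\<^sub>R \<nu>"
        unfolding vec_eq_iff vector_smult_component vector_scaleR_component
        by (simp add: scaleR_conv_of_real)
      ultimately show ?thesis by (simp only: f_def z\<xi>)
    qed
    from kobayashi_dist_le[OF disc_chain_snoc[OF \<phi> disc _ \<beta> refl this]]
    have "kobayashi_dist \<Omega> z\<^sub>0 z \<le> P + poincare_dist 0 (of_real (t / r0 - 1))"
      by (simp add: P_def)
    also have "poincare_dist 0 (of_real (t / r0 - 1)) \<le> 1/2 * ln (2 * r0 / t)"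
      by (rule poincare_dist_0_shifted[OF t0])
    \<comment> \<open>Replacing \<open>t\<close> by \<open>d / 2\<close> costs only a constant
      factor inside the logarithm, so the coefficient 1/2 survives.\<close>
    also have "\<dots> \<le> 1/2 * ln (4 * r0 * (1 / d))"
      using t0 t(1) d r0(1) by (intro mult_left_mono ln_mono) (auto simp: field_simps)
    also have "\<dots> = 1/2 * ln (4 * r0) + 1/2 * ln (1 / d)"
    proof -
      have "ln (4 * r0 * (1 / d)) = ln (4 * r0) + ln (1 / d)"
        using d(1) r0(1) by (intro ln_mult_pos) auto
      then show ?thesis by (simp only: distrib_left)
    qed
    finally show ?thesis
      using lnD unfolding C_def d_def by linarith
  qed
  have "C > 0" using P lnD by (simp add: C_def)
  with main show ?thesis by blast
qed

end
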